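(* Let $\Lambda$ be a $2$-integral lattice of odd determinant and let $\Pi$ be a set of rational primes. Then every vector $v\in S_\Pi(\Lambda)$ satisfies $v\cdot v\equiv \mathrm{oddity}(\Lambda)/4 \pmod{2\mathbb{Z}_2}$.
   Context: A rational lattice $\Lambda$ is $2$-integral if $u\cdot v\in\mathbb{Z}_2$ for all $u,v\in\Lambda$; "odd determinant" means $\det\Lambda$ is a $2$-adic unit. The oddity is the $2$-adic invariant in $\mathbb{Z}/8$ of Conway–Sloane, Sphere Packings, Lattices and Groups, Chapter 15. The shadow is $S(\Lambda)=\{v\in\Lambda\otimes\mathbb{Q}: 2u\cdot v\equiv u\cdot u \pmod{2\mathbb{Z}_2}\text{ for all }u\in\Lambda\}$. For a set $\Pi$ of primes with complement $\overline{\Pi}$, the $\Pi$-dual $\Lambda^{*_\Pi}$ is the set of $v\in\Lambda\otimes\mathbb{Q}$ with $v\cdot u\in\mathbb{Z}_p$ for all $u\in\Lambda$, $p\in\Pi$, and $v\cdot u\in\mathbb{Z}_p$ for all $u\in\Lambda^*$, $p\notin\Pi$. The $\Pi$-shadow is $S_\Pi(\Lambda)=S(\Lambda^{*_{\overline{\Pi}}})$ if $2\in\Pi$, and $S_\Pi(\Lambda)=\sqrt{l}\,S(\sqrt{l}\,\Lambda^{*_{\overline{\Pi}}})$ if $2\notin\Pi$, where $l$ is the $2$-level of $\Lambda$ (the smallest positive integer $l$ such that $\sqrt{l}\,\Lambda^{*_{\{2\}}}$ is $2$-integral). *)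

theory Defs
  imports "HOL-Analysis.Analysis" "HOL-Computational_Algebra.Primes"
begin

(* Every inner product below is rational, so \<int>\<^sub>p only enters through
   \<int>\<^sub>p \<inter> \<rat>, the rationals with a denominator prime to p, viewed inside the reals. *)
definition padic_ints :: "nat \<Rightarrow> real set" where
  "padic_ints p = {of_int a / of_int b | a b :: int. \<not> int p dvd b}"

definition two_adic_unit :: "real \<Rightarrow> bool" where
  "two_adic_unit x \<longleftrightarrow> x \<noteq> 0 \<and> x \<in> padic_ints 2 \<and> inverse x \<in> padic_ints 2"

definition two_adic_cong :: "real \<Rightarrow> real \<Rightarrow> real \<Rightarrow> bool" where
  "two_adic_cong x y m \<longleftrightarrow> (\<exists>z\<in>padic_ints 2. x - y = m * z)"


definition lattice_basis :: "('n::finite \<Rightarrow> real^'n) \<Rightarrow> (real^'n) set \<Rightarrow> bool" where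
  "lattice_basis b L \<longleftrightarrow>
     inj b \<and> independent (range b) \<and>
     L = {\<Sum>i\<in>UNIV. of_int (c i) *\<^sub>R b i | c :: 'n \<Rightarrow> int. True}"

definition rational_lattice :: "(real^'n::finite) set \<Rightarrow> bool" where
  "rational_lattice L \<longleftrightarrow> (\<exists>b. lattice_basis b L) \<and> (\<forall>u\<in>L. \<forall>v\<in>L. u \<bullet> v \<in> \<rat>)"

(* The Gram determinant does not depend on the basis chosen. *)
definition lattice_det :: "(real^'n::finite) set \<Rightarrow> real" where
  "lattice_det L = (let b = (SOME b. lattice_basis b L) in det (\<chi> i j. b i \<bullet> b j))"

definition two_integral :: "(real^'n::finite) set \<Rightarrow> bool" where
  "two_integral L \<longleftrightarrow> (\<forall>u\<in>L. \<forall>v\<in>L. u \<bullet> v \<in> padic_ints 2)"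

(* L \<otimes> \<rat>: by clearing denominators, every rational combination of elements of a
   lattice L is a rational multiple of a single element. *)
definition rat_span :: "(real^'n::finite) set \<Rightarrow> (real^'n) set" where
  "rat_span L = {q *\<^sub>R u | q u. q \<in> \<rat> \<and> u \<in> L}"

definition dual_lattice :: "(real^'n::finite) set \<Rightarrow> (real^'n) set" where
  "dual_lattice L = {v \<in> rat_span L. \<forall>u\<in>L. v \<bullet> u \<in> \<int>}"

definition pi_dual :: "nat set \<Rightarrow> (real^'n::finite) set \<Rightarrow> (real^'n) set" where
  "pi_dual P L = {v \<in> rat_span L. \<forall>p. prime p \<longrightarrow>
     (p \<in> P \<longrightarrow> (\<forall>u\<in>L. v \<bullet> u \<in> padic_ints p)) \<and>
     (p \<notin> P \<longrightarrow> (\<forall>u\<in>dual_lattice L. v \<bullet> u \<in> padic_ints p))}"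

definition two_level :: "(real^'n::finite) set \<Rightarrow> nat" where
  "two_level L = (LEAST l. 0 < l \<and> two_integral ((*\<^sub>R) (sqrt (real l)) ` pi_dual {2} L))"

definition shadow :: "(real^'n::finite) set \<Rightarrow> (real^'n) set" where
  "shadow L = {v \<in> rat_span L. \<forall>u\<in>L. two_adic_cong (2 * (u \<bullet> v)) (u \<bullet> u) 2}"

definition pi_shadow :: "nat set \<Rightarrow> (real^'n::finite) set \<Rightarrow> (real^'n) set" where
  "pi_shadow P L =
     (let D = pi_dual {p. prime p \<and> p \<notin> P} L; s = sqrt (real (two_level L))
      in if 2 \<in> P then shadow D else (*\<^sub>R) s ` shadow ((*\<^sub>R) s ` D))"


(* The oddity (2-signature) of Conway and Sloane: diagonalize the form over \<rat>, write the
   diagonal entries as 2^k a with a a 2-adic unit, and add up the residues of the a modulo 8,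
   plus 4 for each antisquare, i.e. each entry with k odd and a congruent to 3 or -3 modulo 8. *)

definition two_adic_val :: "real \<Rightarrow> int" where
  "two_adic_val d = (THE k. two_adic_unit (d / 2 powi k))"

definition odd_part :: "real \<Rightarrow> real" where
  "odd_part d = d / 2 powi two_adic_val d"

definition residue8 :: "real \<Rightarrow> int" where
  "residue8 a = (THE t. t \<in> {0..<8} \<and> two_adic_cong a (of_int t) 8)"

definition oddity_term :: "real \<Rightarrow> int" where
  "oddity_term d = (let r = residue8 (odd_part d)
     in r + (if odd (two_adic_val d) \<and> r \<in> {3, 5} then 4 else 0))"

(* Being as many as the dimension, nonzero pairwise orthogonal vectors form a basis of L \<otimes> \<rat>. *)
definition rational_orthogonal_basis :: "('n::finite \<Rightarrow> real^'n) \<Rightarrow> (real^'n) set \<Rightarrow> bool" where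
  "rational_orthogonal_basis w L \<longleftrightarrow>
     (\<forall>i. w i \<in> rat_span L \<and> w i \<noteq> 0) \<and> (\<forall>i j. i \<noteq> j \<longrightarrow> w i \<bullet> w j = 0)"

(* Modulo 8 the sum does not depend on the diagonalization; the representative in {0..<8} of
   the class in \<int>/8 is taken. *)
definition oddity :: "(real^'n::finite) set \<Rightarrow> int" where
  "oddity L = (let w = (SOME w. rational_orthogonal_basis w L)
     in (\<Sum>i\<in>UNIV. oddity_term (w i \<bullet> w i)) mod 8)"

end

(*
  Any two orthogonal bases of a positive definite rational space are connected by a chain of
  orthogonal bases in which consecutive ones differ in a plane: a given vector y is moved into a
  basis by merging two basis vectors on which y has nonzero coefficients.  So the sum of the
  oddity terms modulo 8 is independent of the diagonalization as soon as this holds for binary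
  forms, where it is a finite computation with odd residues modulo 8.

  On the other hand, a lattice that is unimodular over the local ring Z_(2) of the rationals at 2
  splits orthogonally into lines spanned by a vector of odd norm and planes with Gram matrix
  ((even, odd), (odd, even)).  On a line, a characteristic vector c has an odd coefficient, whose
  square is 1 modulo 8; on an even plane it lies in twice the plane, and the oddity terms cancel.
  Hence c.c is congruent to the oddity modulo 8.  For v in the Pi-shadow, 2v is such a vector for
  the lattice localized at 2: the Pi-duals involved all have this localization, and the 2-level
  is 1 because the lattice is unimodular at 2.
*)

theory Submission
  imports Defs
begin

section \<open>Rational numbers integral at 2\<close>

text \<open>Positive definiteness keeps the chain of bases elementary: no nonzero vector is
  isotropic, so every merged plane has a new orthogonal basis. The correction 4 for antisquares is
  indispensable in the binary computation: \<open><1, 2>\<close> is isometric to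
  \<open><3, 6>\<close>, the odd parts add up to 2 and to 6, and only the antisquare 6 = 2 * 3 makes
  the two sums agree modulo 8. The obstacle on the lattice side is that an even plane has no
  orthogonal basis over Z_(2). It can only be diagonalized over the rationals, with entries
  \<open>x\<close> and \<open>D / x\<close> for an even \<open>x\<close>. Splitting the module and
  diagonalizing its rational space are therefore separate constructions, carried along by one
  induction; the frame so obtained also shows that the orthogonal basis chosen in the definition of
  the oddity exists.\<close>

lemma padic_ints_two_iff: "x \<in> padic_ints 2 \<longleftrightarrow> (\<exists>a b. odd b \<and> x = of_int a / of_int b)"
  by (auto simp: padic_ints_def)

lemma padic_ints_two_of_int [simp]: "of_int a \<in> padic_ints 2"
  unfolding padic_ints_two_iff by (rule exI[of _ a], rule exI[of _ 1]) simp

lemma padic_ints_two_zero [simp]: "0 \<in> padic_ints 2"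
  and padic_ints_two_one [simp]: "1 \<in> padic_ints 2"
  using padic_ints_two_of_int[of 0] padic_ints_two_of_int[of 1] by simp_all

lemma padic_ints_two_add:
  assumes "x \<in> padic_ints 2" "y \<in> padic_ints 2"
  shows "x + y \<in> padic_ints 2"
proof -
  obtain a b c d where "odd b" "x = of_int a / of_int b" "odd d" "y = of_int c / of_int d"
    using assms unfolding padic_ints_two_iff by blast
  moreover from this have "b \<noteq> 0" "d \<noteq> 0" by auto
  with calculation have "x + y = of_int (a * d + c * b) / of_int (b * d)"
    by (simp add: add_frac_eq)
  ultimately show ?thesis
    unfolding padic_ints_two_iff by (metis even_mult_iff)
qed

lemma padic_ints_two_mult:
  assumes "x \<in> padic_ints 2" "y \<in> padic_ints 2"
  shows "x * y \<in> padic_ints 2"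
proof -
  obtain a b c d where "odd b" "x = of_int a / of_int b" "odd d" "y = of_int c / of_int d"
    using assms unfolding padic_ints_two_iff by blast
  moreover from this have "x * y = of_int (a * c) / of_int (b * d)"
    by simp
  ultimately show ?thesis
    unfolding padic_ints_two_iff by (metis even_mult_iff)
qed

lemma padic_ints_two_minus: "x \<in> padic_ints 2 \<Longrightarrow> - x \<in> padic_ints 2"
  using padic_ints_two_mult[OF padic_ints_two_of_int[of "-1"], of x] by simp

lemma padic_ints_two_diff:
  "x \<in> padic_ints 2 \<Longrightarrow> y \<in> padic_ints 2 \<Longrightarrow> x - y \<in> padic_ints 2"
  using padic_ints_two_add[OF _ padic_ints_two_minus, of x y] by simp

lemma padic_ints_two_sum:
  "(\<And>i. i \<in> A \<Longrightarrow> f i \<in> padic_ints 2) \<Longrightarrow> sum f A \<in> padic_ints 2"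
  by (induction A rule: infinite_finite_induct) (auto intro: padic_ints_two_add)

lemma padic_ints_two_prod:
  "(\<And>i. i \<in> A \<Longrightarrow> f i \<in> padic_ints 2) \<Longrightarrow> prod f A \<in> padic_ints 2"
  by (induction A rule: infinite_finite_induct) (auto intro: padic_ints_two_mult)

text \<open>Clears finitely many denominators by one scalar that is a unit at 2, so that parities
  and valuations survive the passage to integers.\<close>

lemma padic_ints_two_odd_denominator:
  assumes "finite A" "A \<subseteq> padic_ints 2"
  obtains m :: int where "odd m" "\<And>x. x \<in> A \<Longrightarrow> of_int m * x \<in> \<int>"
proof -
  have "\<exists>m::int. odd m \<and> (\<forall>x\<in>A. of_int m * x \<in> \<int>)"
    using assms
  proof (induction A rule: finite_induct)
    case empty
    then show ?case by (intro exI[of _ 1]) auto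
  next
    case (insert x A)
    then obtain m :: int where m: "odd m" "\<forall>x\<in>A. of_int m * x \<in> \<int>" by auto
    obtain a b where b: "odd b" "x = of_int a / of_int b"
      using insert.prems padic_ints_two_iff[of x] by auto
    have "b \<noteq> 0" using b(1) by auto
    have "of_int (m * b) * y \<in> \<int>" if "y \<in> insert x A" for y
    proof (cases "y = x")
      case True
      then have "of_int (m * b) * y = of_int (m * a)" using b \<open>b \<noteq> 0\<close> by simp
      then show ?thesis by (simp only: Ints_of_int)
    next
      case False
      then have "of_int m * y \<in> \<int>" using that m(2) by auto
      then have "of_int b * (of_int m * y) \<in> \<int>" by (rule Ints_mult[OF Ints_of_int])
      then show ?thesis by (simp add: mult_ac)
    qed
    then show ?case using m(1) b(1) by (intro exI[of _ "m * b"]) auto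
  qed
  then show thesis using that by blast
qed

lemma two_adic_unit_iff:
  "two_adic_unit x \<longleftrightarrow> (\<exists>p q. odd p \<and> odd q \<and> x = of_int p / of_int q)"
proof
  assume x: "two_adic_unit x"
  then obtain a b where b: "odd b" "x = of_int a / of_int b"
    unfolding two_adic_unit_def padic_ints_two_iff by blast
  from x obtain c d where d: "odd d" "inverse x = of_int c / of_int d"
    unfolding two_adic_unit_def padic_ints_two_iff by blast
  have nz: "b \<noteq> 0" "d \<noteq> 0" "x \<noteq> 0" using x b d by (auto simp: two_adic_unit_def)
  have "x * inverse x = 1" using nz by simp
  then have "of_int (a * c) = (of_int (b * d) :: real)"
    unfolding b(2) d(2)[unfolded b(2)] using nz by (simp add: field_simps)
  then have "a * c = b * d" by (simp only: of_int_eq_iff)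
  then have "odd a" using b d by (metis even_mult_iff)
  then show "\<exists>p q. odd p \<and> odd q \<and> x = of_int p / of_int q" using b by blast
next
  assume "\<exists>p q. odd p \<and> odd q \<and> x = of_int p / of_int q"
  then obtain p q where pq: "odd p" "odd q" "x = of_int p / of_int q" by blast
  then have "p \<noteq> 0" "q \<noteq> 0" by auto
  with pq show "two_adic_unit x"
    unfolding two_adic_unit_def padic_ints_two_iff by (auto simp: inverse_eq_divide)
qed

lemma padic_ints_two_unit_or_even:
  assumes "x \<in> padic_ints 2"
  shows "two_adic_unit x \<or> x / 2 \<in> padic_ints 2"
proof -
  obtain a b where b: "odd b" "x = of_int a / of_int b"
    using assms unfolding padic_ints_two_iff by blast
  show ?thesis
  proof (cases "even a")
    case True
    then obtain a' where "a = 2 * a'" by blast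
    then have "x / 2 = of_int a' / of_int b" using b by simp
    then show ?thesis using b(1) unfolding padic_ints_two_iff by blast
  next
    case False
    then show ?thesis using b unfolding two_adic_unit_iff by blast
  qed
qed

text \<open>If \<open>l\<close> exceeded \<open>k\<close>, cross-multiplication would make the
  product of the odd numbers \<open>p\<close> and \<open>q'\<close> even. Used in both directions,
  this is the uniqueness behind the definite description in \<open>two_adic_val\<close>.\<close>

lemma two_powi_odd_quotient_eq_imp_exponent_le:
  assumes "odd p" "odd q'" "q \<noteq> 0" "q' \<noteq> 0"
    and eq: "2 powi k * (of_int p / of_int q) = 2 powi l * (of_int p' / of_int q' :: real)"
  shows "l \<le> k"
proof (rule ccontr)
  assume "\<not> l \<le> k"
  then obtain n where n: "l = k + int (Suc n)"
    by (metis zless_iff_Suc_zadd not_le)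
  have "2 powi l = (2 powi k * 2 ^ Suc n :: real)"
    unfolding n power_int_add[OF disjI1[OF zero_neq_numeral[symmetric]]] power_int_of_nat ..
  then have "2 powi k * (of_int p / of_int q) = 2 powi k * (2 ^ Suc n * (of_int p' / of_int q' :: real))"
    unfolding eq by (simp only: mult.assoc)
  then have "of_int p / of_int q = 2 ^ Suc n * (of_int p' / of_int q' :: real)"
    by (subst (asm) mult_cancel_left) simp
  then have "of_int (p * q') = (of_int (2 ^ Suc n * p' * q) :: real)"
    using assms(3,4) by (simp add: field_simps)
  then have "p * q' = 2 ^ Suc n * p' * q" by (simp only: of_int_eq_iff)
  then have "even (p * q')" by simp
  then show False using assms by simp
qed

lemma two_adic_val_two_powi_mult:
  assumes "odd p" "odd q"
  shows "two_adic_val (2 powi k * (of_int p / of_int q)) = k"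
  unfolding two_adic_val_def
proof (rule the_equality)
  show "two_adic_unit (2 powi k * (real_of_int p / real_of_int q) / 2 powi k)"
    using assms by (auto simp: two_adic_unit_iff)
next
  fix l
  assume "two_adic_unit (2 powi k * (real_of_int p / real_of_int q) / 2 powi l)"
  then obtain p' q' where pq: "odd p'" "odd q'"
    "2 powi k * (real_of_int p / real_of_int q) / 2 powi l = of_int p' / of_int q'"
    unfolding two_adic_unit_iff by blast
  then have eq: "2 powi k * (of_int p / of_int q) = 2 powi l * (of_int p' / of_int q' :: real)"
    by (simp add: eq_divide_eq divide_eq_eq mult.commute split: if_splits)
  have "q \<noteq> 0" "q' \<noteq> 0" using assms pq by auto
  then show "l = k"
    using two_powi_odd_quotient_eq_imp_exponent_le[OF _ _ _ _ eq]
      two_powi_odd_quotient_eq_imp_exponent_le[OF _ _ _ _ eq[symmetric]] assms pq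
    by (intro antisym) auto
qed

lemma padic_ints_two_Rats: "x \<in> padic_ints 2 \<Longrightarrow> x \<in> \<rat>"
  unfolding padic_ints_two_iff by auto

lemma two_adic_cong_iff: "m \<noteq> 0 \<Longrightarrow> two_adic_cong x y m \<longleftrightarrow> (x - y) / m \<in> padic_ints 2"
  unfolding two_adic_cong_def by (auto simp: field_simps intro!: bexI[of _ "(x - y) / m"])

lemma two_adic_unit_iff_half: "two_adic_unit x \<longleftrightarrow> x \<in> padic_ints 2 \<and> x / 2 \<notin> padic_ints 2"
proof (intro iffI conjI)
  assume x: "two_adic_unit x"
  then show "x \<in> padic_ints 2" by (simp add: two_adic_unit_def)
  show "x / 2 \<notin> padic_ints 2"
  proof
    assume "x / 2 \<in> padic_ints 2"
    then have "x / 2 * inverse x \<in> padic_ints 2"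
      using x by (intro padic_ints_two_mult) (auto simp: two_adic_unit_def)
    moreover have "x / 2 * inverse x = 1 / 2" using x by (simp add: two_adic_unit_def)
    ultimately obtain a b where "odd b" "1 / 2 = (of_int a / of_int b :: real)"
      unfolding padic_ints_two_iff by auto
    moreover from this have "b \<noteq> 0" by auto
    ultimately have "of_int b = (of_int (2 * a) :: real)" by (simp add: field_simps)
    then have "b = 2 * a" by (simp only: of_int_eq_iff)
    then show False using \<open>odd b\<close> by simp
  qed
next
  assume "x \<in> padic_ints 2 \<and> x / 2 \<notin> padic_ints 2"
  then show "two_adic_unit x" using padic_ints_two_unit_or_even by blast
qed

lemma two_adic_unit_mult:
  "two_adic_unit x \<Longrightarrow> two_adic_unit y \<Longrightarrow> two_adic_unit (x * y)"
  unfolding two_adic_unit_def by (simp add: padic_ints_two_mult)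

lemma two_adic_unit_divide:
  "x \<in> padic_ints 2 \<Longrightarrow> two_adic_unit y \<Longrightarrow> x / y \<in> padic_ints 2"
  unfolding two_adic_unit_def by (simp add: padic_ints_two_mult divide_inverse)

lemma odd_mod_8_cases: "odd (p::int) \<Longrightarrow> p mod 8 \<in> {1, 3, 5, 7}"
  by (simp, presburger)

lemma odd_square_mod_8: "odd (q::int) \<Longrightarrow> (q * q) mod 8 = 1"
  using odd_mod_8_cases[of q] mod_mult_eq[of q 8 q] by auto

lemma two_adic_unit_square_cong:
  assumes "two_adic_unit x"
  shows "(x\<^sup>2 - 1) / 8 \<in> padic_ints 2"
proof -
  obtain p q where pq: "odd p" "odd q" "x = of_int p / of_int q"
    using assms two_adic_unit_iff by blast
  then have q0: "q \<noteq> 0" by auto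
  have "(p * p) mod 8 = (q * q) mod 8" using pq odd_square_mod_8 by metis
  then obtain k where "p * p - q * q = 8 * k" by (auto simp: mod_eq_dvd_iff)
  then have "of_int (p * p - q * q) = (of_int (8 * k) :: real)" by (simp only:)
  then have "(x\<^sup>2 - 1) / 8 = of_int k / of_int (q * q)"
    unfolding pq(3) using q0 by (simp add: power2_eq_square field_simps)
  then show ?thesis unfolding padic_ints_two_iff using pq(2) by (metis even_mult_iff)
qed

lemma int_two_power_decomposition:
  assumes "(a::int) \<noteq> 0"
  obtains k p where "odd p" "a = 2 ^ k * p"
proof (rule multiplicity_decompose'[of a 2])
  show "\<not> is_unit (2::int)" by simp
qed (use assms that in auto)

text \<open>Halving a vector divides its norm by 4, hence the powers of 4: a nonzero vector cannot
  be halved forever inside a 2-integral module.\<close>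

lemma padic_ints_two_not_infinitely_divisible:
  assumes "x \<in> padic_ints 2" "x \<noteq> 0"
  shows "\<exists>k. x / 4 ^ k \<notin> padic_ints 2"
proof -
  obtain a b where ab: "odd b" "x = of_int a / of_int b"
    using assms(1) unfolding padic_ints_two_iff by blast
  then have "a \<noteq> 0" "b \<noteq> 0" using assms(2) by auto
  obtain m p where p: "odd p" "a = 2 ^ m * p" by (rule int_two_power_decomposition[OF \<open>a \<noteq> 0\<close>])
  \<comment> \<open>\<open>Suc m\<close> rather than \<open>m\<close>: for odd \<open>a\<close> the
    exponent \<open>m\<close> is 0 and nothing would be divided. After cancelling
    \<open>2 ^ m\<close> the even factor \<open>4 * 2 ^ m\<close> is left over.\<close>
  have "x / 4 ^ Suc m \<notin> padic_ints 2"
  proof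
    assume "x / 4 ^ Suc m \<in> padic_ints 2"
    then obtain c d where cd: "odd d" "x / 4 ^ Suc m = of_int c / of_int d"
      unfolding padic_ints_two_iff by blast
    then have "d \<noteq> 0" by auto
    have "of_int (a * d) = (of_int (c * b * 4 ^ Suc m) :: real)"
      using cd(2) \<open>d \<noteq> 0\<close> \<open>b \<noteq> 0\<close> unfolding ab(2) by (simp add: field_simps)
    then have "a * d = c * b * 4 ^ Suc m" by (simp only: of_int_eq_iff)
    moreover have "(4::int) ^ Suc m = 2 ^ m * (4 * 2 ^ m)"
      by (simp flip: power_mult_distrib)
    ultimately have "2 ^ m * (p * d) = 2 ^ m * (c * b * (4 * 2 ^ m))"
      using p(2) by (simp add: mult_ac)
    then have "p * d = c * b * (4 * 2 ^ m)"
      by (subst (asm) mult_cancel_left) simp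
    moreover have "odd (p * d)" using p(1) cd(1) by simp
    ultimately show False by simp
  qed
  then show ?thesis by blast
qed

lemma two_adic_cong_of_int_mod:
  assumes "a mod m = b mod m"
  shows "two_adic_cong (of_int a) (of_int b) (of_int m)"
proof -
  obtain z where "a - b = m * z" using assms by (auto simp: mod_eq_dvd_iff)
  then have "of_int a - of_int b = (of_int m * of_int z :: real)"
    by (metis of_int_diff of_int_mult)
  then show ?thesis unfolding two_adic_cong_def by auto
qed

lemma two_adic_cong_refl [simp]: "two_adic_cong x x m"
  unfolding two_adic_cong_def by (intro bexI[of _ 0]) auto

lemma two_adic_cong_add:
  assumes "two_adic_cong x y m" "two_adic_cong x' y' m"
  shows "two_adic_cong (x + x') (y + y') m"
proof -
  obtain z z' where z: "z \<in> padic_ints 2" "z' \<in> padic_ints 2" "x - y = m * z" "x' - y' = m * z'"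
    using assms unfolding two_adic_cong_def by blast
  then have "x + x' - (y + y') = m * (z + z')" by (simp add: algebra_simps)
  then show ?thesis unfolding two_adic_cong_def using z padic_ints_two_add by blast
qed

lemma two_adic_cong_trans:
  assumes "two_adic_cong x y m" "two_adic_cong y z m"
  shows "two_adic_cong x z m"
proof -
  have "two_adic_cong (x + y - y) (y + z - y) m"
    using two_adic_cong_add[OF two_adic_cong_add[OF assms] two_adic_cong_refl[of "- y"]] by simp
  then show ?thesis by simp
qed

section \<open>Oddity terms\<close>

text \<open>An odd \<open>q\<close> is its own inverse modulo 8, so dividing by \<open>q\<close> and
  multiplying by \<open>q\<close> give the same residue.\<close>

lemma two_adic_cong_quotient_iff:
  assumes "odd q"
  shows "two_adic_cong (of_int p / of_int q) (of_int t) 8 \<longleftrightarrow> (p * q) mod 8 = t mod 8"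
proof -
  have q0: "q \<noteq> 0" using assms by auto
  have sq: "q * q mod 8 = 1" by (rule odd_square_mod_8[OF assms])
  have "8 dvd q * (p - t * q) \<longleftrightarrow> 8 dvd p * q - t"
  proof -
    have "q * (p - t * q) = (p * q - t) - t * (q * q - 1)" by algebra
    moreover have "8 dvd t * (q * q - 1)" using sq mod_eq_dvd_iff[of "q * q" 8 1] by simp
    ultimately show ?thesis by presburger
  qed
  moreover have "coprime (8::int) q"
    using assms coprime_power_left_iff[of 2 3 q] by simp
  ultimately have *: "8 dvd p - t * q \<longleftrightarrow> 8 dvd p * q - t"
    by (simp add: coprime_dvd_mult_right_iff)
  have "two_adic_cong (of_int p / of_int q) (of_int t) 8 \<longleftrightarrow> 8 dvd p - t * q"
  proof
    assume "8 dvd p - t * q"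
    then obtain z where "p - t * q = 8 * z" by blast
    then have "p = t * q + 8 * z" by simp
    then have "of_int p / of_int q - of_int t = 8 * (of_int z / of_int q :: real)"
      using q0 by (simp add: field_simps)
    then show "two_adic_cong (of_int p / of_int q) (of_int t) 8"
      using assms unfolding two_adic_cong_def Bex_def padic_ints_two_iff by blast
  next
    assume "two_adic_cong (of_int p / of_int q) (of_int t) 8"
    then obtain a b where ab: "odd b" "of_int p / of_int q - of_int t = 8 * (of_int a / of_int b :: real)"
      unfolding two_adic_cong_def Bex_def padic_ints_two_iff by blast
    then have "b \<noteq> 0" by auto
    with ab q0 have "of_int ((p - t * q) * b) = (of_int (8 * a * q) :: real)"
      by (simp add: field_simps)
    then have "(p - t * q) * b = 8 * a * q" by (simp only: of_int_eq_iff)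
    then have "8 dvd (p - t * q) * b" by simp
    moreover have "coprime (8::int) b"
      using ab(1) coprime_power_left_iff[of 2 3 b] by simp
    ultimately show "8 dvd p - t * q" by (simp add: coprime_dvd_mult_left_iff)
  qed
  with * show ?thesis by (simp add: mod_eq_dvd_iff)
qed

lemma residue8_quotient:
  assumes "odd q"
  shows "residue8 (of_int p / of_int q) = (p * q) mod 8"
  unfolding residue8_def two_adic_cong_quotient_iff[OF assms]
  by (rule the_equality) auto

text \<open>The oddity term in terms of the only data it depends on: whether the exponent of 2 is
  odd, and the odd part modulo 8. Identities between oddity terms thereby become finite
  enumerations.\<close>

definition signed_residue :: "bool \<Rightarrow> int \<Rightarrow> int" where
  "signed_residue b r = r mod 8 + (if b \<and> r mod 8 \<in> {3, 5} then 4 else 0)"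

lemma oddity_term_two_powi_mult:
  assumes "odd p" "odd q"
  shows "oddity_term (2 powi k * (of_int p / of_int q)) = signed_residue (odd k) (p * q)"
  unfolding oddity_term_def odd_part_def two_adic_val_two_powi_mult[OF assms]
  by (simp add: residue8_quotient[OF assms(2)] signed_residue_def)

lemma oddity_term_int:
  assumes "odd p"
  shows "oddity_term (of_int (2 ^ k * p)) = signed_residue (odd k) p"
  using oddity_term_two_powi_mult[of p 1 "int k"] assms by simp

lemma rat_two_powi_decomposition:
  assumes "x \<in> \<rat>" "x \<noteq> (0::real)"
  obtains k p q where "odd p" "odd q" "x = 2 powi k * (of_int p / of_int q)"
proof -
  obtain a b where ab: "b \<noteq> 0" "x = of_int a / of_int b"
    using Rats_cases'[OF assms(1)] by (metis less_irrefl)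
  then have "a \<noteq> 0" using assms by auto
  obtain k p where p: "odd p" "a = 2 ^ k * p" by (rule int_two_power_decomposition[OF \<open>a \<noteq> 0\<close>])
  obtain l q where q: "odd q" "b = 2 ^ l * q" by (rule int_two_power_decomposition[OF \<open>b \<noteq> 0\<close>])
  have "x = 2 powi (int k - int l) * (of_int p / of_int q)"
    unfolding ab(2) p q by (simp add: power_int_diff)
  with p q that show thesis by blast
qed

text \<open>A square shifts the exponent of 2 by an even number and multiplies the odd part by
  something that is 1 modulo 8. Hence vectors may be rescaled and denominators cleared by
  squares.\<close>

lemma oddity_term_mult_square:
  assumes "x \<in> \<rat>" "x \<noteq> 0" "d \<in> \<rat>" "d \<noteq> 0"
  shows "oddity_term (x\<^sup>2 * d) = oddity_term d"
proof -
  obtain k p q where 1: "odd p" "odd q" "x = 2 powi k * (of_int p / of_int q)"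
    using rat_two_powi_decomposition assms by metis
  obtain l r s where 2: "odd r" "odd s" "d = 2 powi l * (of_int r / of_int s)"
    using rat_two_powi_decomposition assms by metis
  have *: "(A * (a / b))\<^sup>2 * (B * (c / e)) = (A * A * B) * (a * a * c / (b * b * e))"
    for A B a b c e :: real
    by (simp add: power2_eq_square)
  have "2 powi (2 * k + l) = (2 powi k * 2 powi k * 2 powi l :: real)"
    by (simp only: power_int_add[OF disjI1[OF zero_neq_numeral[symmetric]]] mult_2)
  then have "x\<^sup>2 * d = 2 powi (2 * k + l) * (of_int (p * p * r) / of_int (q * q * s))"
    unfolding 1 2 using *[of "2 powi k"] by (simp only: of_int_mult)
  moreover have "(p * p * r * (q * q * s)) mod 8 = (r * s) mod 8"
  proof -
    have "(p * p * r * (q * q * s)) mod 8 = ((p * p) * ((q * q) * (r * s))) mod 8"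
      by (simp only: mult_ac)
    also have "\<dots> = (((p * p) mod 8) * ((((q * q) mod 8) * (r * s)) mod 8)) mod 8"
      by (simp only: mod_mult_left_eq mod_mult_right_eq)
    also have "\<dots> = (r * s) mod 8"
      by (simp only: odd_square_mod_8[OF 1(1)] odd_square_mod_8[OF 1(2)] mult_1 mod_mod_trivial)
    finally show ?thesis .
  qed
  ultimately have "oddity_term (x\<^sup>2 * d) = signed_residue (odd (2 * k + l)) (p * p * r * (q * q * s))"
    using oddity_term_two_powi_mult[of "p * p * r" "q * q * s" "2 * k + l"] 1(1,2) 2(1,2)
    by (simp only: even_mult_iff not_False_eq_True simp_thms)
  also have "\<dots> = signed_residue (odd l) (r * s)"
    unfolding signed_residue_def \<open>(p * p * r * (q * q * s)) mod 8 = (r * s) mod 8\<close> by simp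
  also have "\<dots> = oddity_term d"
    unfolding 2(3) by (rule oddity_term_two_powi_mult[OF 2(1,2), symmetric])
  finally show ?thesis .
qed

section \<open>Finite identities modulo 8 behind the isometries of binary forms\<close>

lemma signed_residue_cong: "x mod 8 = y mod 8 \<Longrightarrow> signed_residue b x = signed_residue b y"
  by (simp add: signed_residue_def)

text \<open>The residues of \<open>r\<close> and \<open>- r\<close> add up to 8, and since {3, 5} is
  stable under negation modulo 8, the correction occurs twice or not at all.\<close>

lemma signed_residue_neg:
  assumes "odd r"
  shows "(signed_residue b r + signed_residue b (- r)) mod 8 = 0"
proof -
  have "\<forall>r\<in>{1, 3, 5, 7}. (signed_residue b r + signed_residue b (- r)) mod 8 = 0"
    by (simp add: signed_residue_def)
  moreover have "signed_residue b r = signed_residue b (r mod 8)"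
    "signed_residue b (- r) = signed_residue b (- (r mod 8))"
    by (rule signed_residue_cong, simp add: mod_simps)+
  ultimately show ?thesis using odd_mod_8_cases[OF assms] by metis
qed

text \<open>The entries are \<open>2 ^ i * r\<close> and \<open>2 ^ (i + 1) * s\<close>, with
  \<open>b\<close> telling whether \<open>i\<close> is odd. Their sum has exponent i, and the
  product of both with the sum has exponent 3 i + 1, which has the parity opposite to i.\<close>

lemma signed_residue_sum_double:
  assumes "odd r" "odd s"
  shows "(signed_residue b r + signed_residue (\<not> b) s) mod 8 =
    (signed_residue b (r + 2 * s) + signed_residue (\<not> b) (r * s * (r + 2 * s))) mod 8"
proof -
  have "\<forall>r\<in>{1, 3, 5, 7}. \<forall>s\<in>{1, 3, 5, 7}. (signed_residue b r + signed_residue (\<not> b) s) mod 8 =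
    (signed_residue b (r + 2 * s) + signed_residue (\<not> b) (r * s * (r + 2 * s))) mod 8"
    by (cases b) (simp_all add: signed_residue_def)
  moreover have "signed_residue b r = signed_residue b (r mod 8)"
    "signed_residue c s = signed_residue c (s mod 8)"
    "signed_residue b (r + 2 * s) = signed_residue b (r mod 8 + 2 * (s mod 8))"
    "signed_residue c (r * s * (r + 2 * s)) =
      signed_residue c ((r mod 8) * (s mod 8) * (r mod 8 + 2 * (s mod 8)))" for c
    by (intro signed_residue_cong mod_add_cong mod_diff_cong mod_mult_cong refl
        mod_mod_trivial[symmetric])+
  ultimately show ?thesis using odd_mod_8_cases[OF assms(1)] odd_mod_8_cases[OF assms(2)] by metis
qed

text \<open>The case of exponents i and i + 2, where all four parities agree.\<close>

lemma signed_residue_sum_quadruple: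
  assumes "odd r" "odd s"
  shows "(signed_residue b r + signed_residue b s) mod 8 =
    (signed_residue b (r + 4 * s) + signed_residue b (r * s * (r + 4 * s))) mod 8"
proof -
  have "\<forall>r\<in>{1, 3, 5, 7}. \<forall>s\<in>{1, 3, 5, 7}. (signed_residue b r + signed_residue b s) mod 8 =
    (signed_residue b (r + 4 * s) + signed_residue b (r * s * (r + 4 * s))) mod 8"
    by (cases b) (simp_all add: signed_residue_def)
  moreover have "signed_residue b r = signed_residue b (r mod 8)"
    "signed_residue b s = signed_residue b (s mod 8)"
    "signed_residue b (r + 4 * s) = signed_residue b (r mod 8 + 4 * (s mod 8))"
    "signed_residue b (r * s * (r + 4 * s)) =
      signed_residue b ((r mod 8) * (s mod 8) * (r mod 8 + 4 * (s mod 8)))"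
    by (intro signed_residue_cong mod_add_cong mod_diff_cong mod_mult_cong refl
        mod_mod_trivial[symmetric])+
  ultimately show ?thesis using odd_mod_8_cases[OF assms(1)] odd_mod_8_cases[OF assms(2)] by metis
qed

text \<open>The case of equal exponents with odd parts adding up to twice an odd number:
  \<open>s\<close> is the odd part of the sum, and \<open>2 * s - r\<close> is the second odd part.
  The factor 2 flips the parity on the right.\<close>

lemma signed_residue_half_sum:
  assumes "odd r" "odd s"
  shows "(signed_residue b r + signed_residue b (2 * s - r)) mod 8 =
    (signed_residue (\<not> b) s + signed_residue (\<not> b) (r * (2 * s - r) * s)) mod 8"
proof -
  have "\<forall>r\<in>{1, 3, 5, 7}. \<forall>s\<in>{1, 3, 5, 7}.
    (signed_residue b r + signed_residue b (2 * s - r)) mod 8 =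
    (signed_residue (\<not> b) s + signed_residue (\<not> b) (r * (2 * s - r) * s)) mod 8"
    by (cases b) (simp_all add: signed_residue_def)
  moreover have "signed_residue b r = signed_residue b (r mod 8)"
    "signed_residue c s = signed_residue c (s mod 8)"
    "signed_residue b (2 * s - r) = signed_residue b (2 * (s mod 8) - r mod 8)"
    "signed_residue c (r * (2 * s - r) * s) =
      signed_residue c ((r mod 8) * (2 * (s mod 8) - r mod 8) * (s mod 8))" for c
    by (intro signed_residue_cong mod_add_cong mod_diff_cong mod_mult_cong refl
        mod_mod_trivial[symmetric])+
  ultimately show ?thesis using odd_mod_8_cases[OF assms(1)] odd_mod_8_cases[OF assms(2)] by metis
qed

text \<open>Equal exponents again, now with odd parts adding up to four times the odd number
  \<open>s\<close>; the factor 4 preserves the parity.\<close>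

lemma signed_residue_quarter_sum:
  assumes "odd r" "odd s"
  shows "(signed_residue b r + signed_residue b (4 * s - r)) mod 8 =
    (signed_residue b s + signed_residue b (r * (4 * s - r) * s)) mod 8"
proof -
  have "\<forall>r\<in>{1, 3, 5, 7}. \<forall>s\<in>{1, 3, 5, 7}.
    (signed_residue b r + signed_residue b (4 * s - r)) mod 8 =
    (signed_residue b s + signed_residue b (r * (4 * s - r) * s)) mod 8"
    by (cases b) (simp_all add: signed_residue_def)
  moreover have "signed_residue b r = signed_residue b (r mod 8)"
    "signed_residue b s = signed_residue b (s mod 8)"
    "signed_residue b (4 * s - r) = signed_residue b (4 * (s mod 8) - r mod 8)"
    "signed_residue b (r * (4 * s - r) * s) =
      signed_residue b ((r mod 8) * (4 * (s mod 8) - r mod 8) * (s mod 8))"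
    by (intro signed_residue_cong mod_add_cong mod_diff_cong mod_mult_cong refl
        mod_mod_trivial[symmetric])+
  ultimately show ?thesis using odd_mod_8_cases[OF assms(1)] odd_mod_8_cases[OF assms(2)] by metis
qed

lemma odd_square_mult_mod_8:
  assumes "odd (r::int)" "r' mod 8 = r mod 8"
  shows "(r * s * r') mod 8 = s mod 8"
proof -
  have "(r * s * r') mod 8 = (r * s * r) mod 8"
    by (rule mod_mult_cong[OF refl assms(2)])
  also have "\<dots> = (r * r * s) mod 8" by (simp only: mult_ac)
  also have "\<dots> = ((r * r) mod 8 * s) mod 8" by (simp only: mod_mult_left_eq)
  also have "\<dots> = s mod 8" by (simp add: odd_square_mod_8[OF assms(1)])
  finally show ?thesis .
qed

text \<open>Residues do not see multiples of 8, so few cases remain. For \<open>e\<close> at least 3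
  the terms on both sides agree one by one; for \<open>e = 0\<close> and \<open>r + s\<close>
  divisible by 8 both sides reduce to \<open>signed_residue_neg\<close>. What is left is
  \<open>e\<close> = 1 or 2, and \<open>r + s\<close> divisible by exactly 2 or 4.\<close>

lemma oddity_term_int_add_ordered:
  fixes r s :: int
  assumes "odd r" "odd s" and nz: "2 ^ i * r + 2 ^ (i + e) * s \<noteq> 0"
  defines "a \<equiv> 2 ^ i * r" and "b \<equiv> 2 ^ (i + e) * s"
  shows "(oddity_term (of_int a) + oddity_term (of_int b)) mod 8 =
    (oddity_term (of_int (a + b)) + oddity_term (of_int (a * b * (a + b)))) mod 8"
proof -
  have t: "oddity_term (of_int a) = signed_residue (odd i) r"
    "oddity_term (of_int b) = signed_residue (odd (i + e)) s"
    unfolding a_def b_def using assms by (intro oddity_term_int; simp)+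
  \<comment> \<open>Here \<open>f\<close> is the additional power of 2 in \<open>a + b\<close>. The
    exponent of \<open>a * b * (a + b)\<close> is \<open>3 * i + e + f\<close>, which has the parity
    of \<open>i + e + f\<close>.\<close>
  have sum: "oddity_term (of_int (a + b)) = signed_residue (odd (i + f)) g \<and>
    oddity_term (of_int (a * b * (a + b))) = signed_residue (odd (i + e + f)) (r * s * g)"
    if "odd g" "r + 2 ^ e * s = 2 ^ f * g" for f g
  proof -
    have ab: "a + b = 2 ^ (i + f) * g"
      unfolding a_def b_def using that(2) by (simp add: power_add mult.assoc flip: distrib_left)
    then have "a * b * (a + b) = 2 ^ (i + (i + e) + (i + f)) * (r * s * g)"
      unfolding a_def b_def by (simp add: power_add mult_ac)
    then have "oddity_term (of_int (a * b * (a + b))) =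
        signed_residue (odd (i + (i + e) + (i + f))) (r * s * g)"
      using oddity_term_int[of "r * s * g"] assms(1,2) that(1) by (simp only: even_mult_iff simp_thms)
    moreover have "odd (i + (i + e) + (i + f)) = odd (i + e + f)" by auto
    ultimately show ?thesis
      unfolding ab oddity_term_int[OF that(1)] by simp
  qed
  consider "e = 0" | "e = 1" | "e = 2" | "e \<ge> 3" by linarith
  then show ?thesis
  proof cases
    case 1
    then have "r + s \<noteq> 0" using nz by (auto simp flip: distrib_left)
    then obtain f g where g: "odd g" "r + s = 2 ^ f * g"
      by (rule int_two_power_decomposition)
    then have s: "s = 2 ^ f * g - r" by simp
    have "f \<noteq> 0" using g assms(1,2) by (metis even_add mult_1 power_0)
    then consider "f = 1" | "f = 2" | "f \<ge> 3" by linarith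
    then show ?thesis
    proof cases
      case 3
      then obtain f' where "f = 3 + f'" using le_Suc_ex by blast
      then have "2 ^ f = (8 * 2 ^ f' :: int)" by (simp add: power_add)
      \<comment> \<open>Modulo 8, \<open>s\<close> is \<open>- r\<close> and
        \<open>r * s * g\<close> is \<open>- g\<close>, so both sides of the claim vanish.\<close>
      then have sm: "s mod 8 = (- r) mod 8"
        unfolding s using mod_diff_left_eq[of "2 ^ f * g" 8 r] by (simp add: mult.assoc)
      have "(r * s * g) mod 8 = (r * (- r) * g) mod 8"
        by (intro mod_mult_cong refl sm)
      also have "\<dots> = (r * (- g) * r) mod 8" by (simp add: mult_ac)
      also have "\<dots> = (- g) mod 8" by (rule odd_square_mult_mod_8[OF assms(1) refl])
      finally have "signed_residue (odd (i + f)) (r * s * g) = signed_residue (odd (i + f)) (- g)"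
        by (rule signed_residue_cong)
      moreover have "signed_residue (odd i) s = signed_residue (odd i) (- r)"
        by (rule signed_residue_cong[OF sm])
      ultimately show ?thesis
        using sum[of g f] g t 1 signed_residue_neg[OF assms(1), of "odd i"]
          signed_residue_neg[OF g(1), of "odd (i + f)"] by simp
    qed (use sum[of g f] g 1 t s signed_residue_half_sum[OF assms(1) g(1), of "odd i"]
          signed_residue_quarter_sum[OF assms(1) g(1), of "odd i"] in auto)
  next
    case 4
    then obtain e' where "e = 3 + e'" using le_Suc_ex by blast
    then have "2 ^ e = (8 * 2 ^ e' :: int)" by (simp add: power_add)
    then have "(r + 2 ^ e * s) mod 8 = r mod 8" by (simp add: mult.assoc)
    moreover have "odd (r + 2 ^ e * s)" using 4 assms by simp
    ultimately show ?thesis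
      using sum[of "r + 2 ^ e * s" 0] t odd_square_mult_mod_8[OF assms(1), of "r + 2 ^ e * s" s]
        signed_residue_cong
      by (metis add_0_right mult_1 power_0)
  qed (use sum[of "r + 2 ^ e * s" 0] t assms signed_residue_sum_double[OF assms(1,2), of "odd i"]
          signed_residue_sum_quadruple[OF assms(1,2), of "odd i"] in auto)
qed

lemma oddity_term_int_add:
  fixes a b :: int
  assumes "a \<noteq> 0" "b \<noteq> 0" "a + b \<noteq> 0"
  shows "(oddity_term (of_int a) + oddity_term (of_int b)) mod 8 =
    (oddity_term (of_int (a + b)) + oddity_term (of_int (a * b * (a + b)))) mod 8"
proof -
  obtain i r where r: "odd r" "a = 2 ^ i * r" by (rule int_two_power_decomposition[OF assms(1)])
  obtain j s where s: "odd s" "b = 2 ^ j * s" by (rule int_two_power_decomposition[OF assms(2)])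
  show ?thesis
  proof (cases "i \<le> j")
    case True
    then obtain e where "j = i + e" using le_Suc_ex by blast
    then show ?thesis using oddity_term_int_add_ordered[of r s i e] r s assms(3) by simp
  next
    case False
    then obtain e where "i = j + e" using le_Suc_ex nat_le_linear by blast
    then show ?thesis using oddity_term_int_add_ordered[of s r j e] r s assms(3)
      by (simp add: ac_simps)
  qed
qed

text \<open>
  The planes \<open>\<langle>a, b\<rangle>\<close> and \<open>\<langle>a + b, a b (a + b)\<rangle>\<close> are isometric; up to scaling the
  diagonal entries by squares every change of orthogonal basis of a rational plane that moves both
  axes is of this form.
\<close>
lemma oddity_term_add:
  assumes "a \<in> \<rat>" "b \<in> \<rat>" "a \<noteq> 0" "b \<noteq> 0" "a + b \<noteq> 0"
  shows "(oddity_term a + oddity_term b) mod 8 =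
    (oddity_term (a + b) + oddity_term (a * b * (a + b))) mod 8"
proof -
  obtain p q where pq: "q \<noteq> 0" "a = of_int p / of_int q"
    using Rats_cases'[OF assms(1)] by (metis less_irrefl)
  obtain r s where rs: "s \<noteq> 0" "b = of_int r / of_int s"
    using Rats_cases'[OF assms(2)] by (metis less_irrefl)
  \<comment> \<open>Multiplying by the square of the common denominator, not by the denominator
    itself, leaves the oddity terms unchanged.\<close>
  define N where "N = q * s"
  define A where "A = p * s * N"
  define B where "B = r * q * N"
  have N0: "real_of_int N \<noteq> 0" using pq rs by (simp add: N_def)
  have A: "of_int A = (of_int N)\<^sup>2 * a" and B: "of_int B = (of_int N)\<^sup>2 * b"
    using pq(1) rs(1) by (simp_all add: A_def B_def N_def pq(2) rs(2) power2_eq_square)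
  have AB: "of_int (A + B) = (of_int N)\<^sup>2 * (a + b)"
    "of_int (A * B * (A + B)) = ((of_int N) ^ 3)\<^sup>2 * (a * b * (a + b))"
    unfolding of_int_mult of_int_add A B by algebra+
  have "real_of_int A \<noteq> 0" "real_of_int B \<noteq> 0" "real_of_int (A + B) \<noteq> 0"
    unfolding AB A B using N0 assms by simp_all
  then have "A \<noteq> 0" "B \<noteq> 0" "A + B \<noteq> 0" by auto
  note * = oddity_term_int_add[OF this]
  have "oddity_term (of_int A) = oddity_term a" "oddity_term (of_int B) = oddity_term b"
    "oddity_term (of_int (A + B)) = oddity_term (a + b)"
    "oddity_term (of_int (A * B * (A + B))) = oddity_term (a * b * (a + b))"
    unfolding AB unfolding A B using N0 assms by (intro oddity_term_mult_square; simp)+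
  then show ?thesis using * by (simp only:)
qed

section \<open>Oddity terms of even unimodular planes\<close>

text \<open>Exactly one of \<open>r\<close> and \<open>3 * r\<close> is 3 or 5 modulo 8, so a single
  4 is added to \<open>4 * r\<close>, which is itself 4 modulo 8. The model is
  \<open><2, 6>\<close>, the diagonal form of the plane ((2, 1), (1, 2)).\<close>

lemma signed_residue_triple:
  assumes "odd r"
  shows "(signed_residue True r + signed_residue True (r * 3)) mod 8 = 0"
proof -
  have "\<forall>r\<in>{1, 3, 5, 7}. (signed_residue True r + signed_residue True (r * 3)) mod 8 = 0"
    by (simp add: signed_residue_def)
  moreover have "signed_residue True r = signed_residue True (r mod 8)"
    "signed_residue True (r * 3) = signed_residue True (r mod 8 * 3)"
    by (intro signed_residue_cong mod_mult_cong refl mod_mod_trivial[symmetric])+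
  ultimately show ?thesis using odd_mod_8_cases[OF assms] by metis
qed

text \<open>Up to squares these are the diagonal entries of the plane ((x, b), (b, y)). Since 4
  divides \<open>x * y\<close>, the determinant is -1 or 3 modulo 8, and 3 forces \<open>x\<close>
  to be twice an odd number. The first case behaves like a hyperbolic plane, the second like ((2,
  1), (1, 2)).\<close>

lemma oddity_term_int_even_plane:
  fixes x y b :: int
  assumes "even x" "even y" "odd b" "x \<noteq> 0"
  shows "(oddity_term (of_int x) + oddity_term (of_int (x * (x * y - b * b)))) mod 8 = 0"
proof -
  obtain k r where r: "odd r" "x = 2 ^ k * r" by (rule int_two_power_decomposition[OF assms(4)])
  have b: "b * b mod 8 = 1" by (rule odd_square_mod_8[OF assms(3)])
  define m where "m = x * y - b * b"
  have m: "odd m" unfolding m_def using assms by simp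
  have xm: "x * m = 2 ^ k * (r * m)" using r by simp
  have t: "oddity_term (of_int x) = signed_residue (odd k) r"
    "oddity_term (of_int (x * m)) = signed_residue (odd k) (r * m)"
    unfolding xm unfolding r(2) using r(1) m by (intro oddity_term_int; simp)+
  obtain y' where y': "y = 2 * y'" using assms(2) by blast
  have "k \<noteq> 0" using assms(1) r by (metis mult_1 power_0)
  then consider "k = 1" | "k \<ge> 2" by linarith
  then have "8 dvd x * y \<or> k = 1 \<and> (x * y) mod 8 = 4"
  proof cases
    case 1
    then have xy: "x * y = 4 * (r * y')" using r y' by simp
    have "8 dvd c \<or> c mod 8 = 4" if "c = 4 * z" for c z :: int
      using that by presburger
    from this[OF xy] show ?thesis using 1 by blast
  next
    case 2
    then obtain l where "k = 2 + l" using le_Suc_ex by blast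
    then have "x * y = 8 * (2 ^ l * r * y')" using r y' by (simp add: power_add)
    then show ?thesis by simp
  qed
  then have "m mod 8 = (- 1) mod 8 \<or> k = 1 \<and> m mod 8 = 3 mod 8"
  proof -
    have "8 dvd c \<Longrightarrow> (c - d) mod 8 = (- 1) mod 8"
      "c mod 8 = 4 \<Longrightarrow> (c - d) mod 8 = 3 mod 8" if "d mod 8 = 1" for c d :: int
      using that by presburger+
    from this[OF b] show ?thesis
      unfolding m_def using \<open>8 dvd x * y \<or> k = 1 \<and> (x * y) mod 8 = 4\<close> by blast
  qed
  then show ?thesis
  proof
    assume "m mod 8 = (- 1) mod 8"
    then have "(r * m) mod 8 = (r * (- 1)) mod 8" by (intro mod_mult_cong refl)
    then have "signed_residue (odd k) (r * m) = signed_residue (odd k) (- r)"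
      by (intro signed_residue_cong) simp
    then show ?thesis using t signed_residue_neg[OF r(1)] by (simp add: m_def)
  next
    assume *: "k = 1 \<and> m mod 8 = 3 mod 8"
    then have "(r * m) mod 8 = (r * 3) mod 8" by (intro mod_mult_cong refl) simp
    then have "signed_residue (odd k) (r * m) = signed_residue (odd k) (r * 3)"
      by (intro signed_residue_cong) simp
    then show ?thesis using t signed_residue_triple[OF r(1)] * by (simp add: m_def)
  qed
qed

lemma oddity_term_even_plane:
  assumes "x / 2 \<in> padic_ints 2" "y / 2 \<in> padic_ints 2" "two_adic_unit b" "x \<noteq> 0"
    and nz: "x * y - b\<^sup>2 \<noteq> 0"
  shows "(oddity_term x + oddity_term ((x * y - b\<^sup>2) / x)) mod 8 = 0"
proof -
  obtain p q where pq: "odd p" "odd q" "b = of_int p / of_int q"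
    using assms(3) two_adic_unit_iff by blast
  have "b \<in> padic_ints 2" using assms(3) by (simp add: two_adic_unit_def)
  \<comment> \<open>Clearing \<open>x / 2\<close> and \<open>y / 2\<close> instead of
    \<open>x\<close> and \<open>y\<close> displays the integers \<open>x'\<close> and
    \<open>y'\<close> as even.\<close>
  then obtain N :: int where N: "odd N"
    "\<And>z. z \<in> {x / 2, y / 2, b} \<Longrightarrow> of_int N * z \<in> \<int>"
    using padic_ints_two_odd_denominator[of "{x / 2, y / 2, b}"] assms(1,2) by blast
  obtain X where X: "of_int N * (x / 2) = of_int X" using N(2)[of "x / 2"] by (auto elim: Ints_cases)
  obtain Y where Y: "of_int N * (y / 2) = of_int Y" using N(2)[of "y / 2"] by (auto elim: Ints_cases)
  obtain B where B: "of_int N * b = of_int B" using N(2)[of b] by (auto elim: Ints_cases)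
  have q0: "q \<noteq> 0" "N \<noteq> 0" using pq N by auto
  have "of_int (N * p) = (of_int (B * q) :: real)"
    using B q0 unfolding pq(3) by (simp add: field_simps)
  then have "N * p = B * q" by (simp only: of_int_eq_iff)
  then have "odd B" using N(1) pq(1) by (metis even_mult_iff)
  define x' where "x' = N * (2 * X)"
  define y' where "y' = N * (2 * Y)"
  define b' where "b' = N * B"
  have rx: "of_int x' = (of_int N)\<^sup>2 * x" "of_int y' = (of_int N)\<^sup>2 * y" "of_int b' = (of_int N)\<^sup>2 * b"
    unfolding x'_def y'_def b'_def of_int_mult X[symmetric] Y[symmetric] B[symmetric]
    by (simp_all add: power2_eq_square)
  have "of_int (x' * (x' * y' - b' * b')) = (of_int N ^ 3 * x)\<^sup>2 * ((x * y - b\<^sup>2) / x)"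
  proof -
    define d where "d = (x * y - b\<^sup>2) / x"
    have d: "x * d = x * y - b\<^sup>2" using assms(4) by (simp add: d_def)
    have "of_int (x' * (x' * y' - b' * b')) = (of_int N) ^ 6 * (x * (x * y - b\<^sup>2))"
      unfolding of_int_mult of_int_diff rx by algebra
    also have "\<dots> = (of_int N ^ 3 * x)\<^sup>2 * d"
      unfolding d[symmetric] by algebra
    finally show ?thesis by (simp only: d_def)
  qed
  moreover have rat: "x \<in> \<rat>" "(x * y - b\<^sup>2) / x \<in> \<rat>"
  proof -
    have R: "z \<in> \<rat>" if "of_int N * z = of_int k" for z k
    proof -
      have "z = of_int k / of_int N" using that q0 by (simp add: field_simps)
      then show ?thesis by simp
    qed
    have "2 * (x / 2) \<in> \<rat>" "2 * (y / 2) \<in> \<rat>" using R[OF X] R[OF Y] by (intro Rats_mult; simp)+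
    then show "x \<in> \<rat>" "(x * y - b\<^sup>2) / x \<in> \<rat>" using R[OF B] by simp_all
  qed
  ultimately have "oddity_term (of_int (x' * (x' * y' - b' * b'))) = oddity_term ((x * y - b\<^sup>2) / x)"
    using q0 assms(4) nz by (simp only:) (intro oddity_term_mult_square; simp)
  moreover have "oddity_term (of_int x') = oddity_term x"
    unfolding rx using q0 assms(4) rat by (intro oddity_term_mult_square) simp_all
  moreover have "(oddity_term (of_int x') + oddity_term (of_int (x' * (x' * y' - b' * b')))) mod 8 = 0"
  proof (rule oddity_term_int_even_plane)
    show "x' \<noteq> 0" using rx(1) q0 assms(4) by (metis mult_eq_0_iff of_int_0_eq_iff power_eq_0_iff)
  qed (use N(1) \<open>odd B\<close> in \<open>simp_all add: x'_def y'_def b'_def\<close>)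
  ultimately show ?thesis by simp
qed

text \<open>A unit has valuation 0, which is even, so there is no antisquare correction and the term
  is the plain residue.\<close>

lemma oddity_term_unit_cong:
  assumes "two_adic_unit a"
  shows "two_adic_cong a (of_int (oddity_term a)) 8"
proof -
  obtain p q where pq: "odd p" "odd q" "a = of_int p / of_int q"
    using assms two_adic_unit_iff by blast
  then show ?thesis
    using oddity_term_two_powi_mult[of p q 0] two_adic_cong_quotient_iff[of q p]
    by (simp add: signed_residue_def)
qed

section \<open>Orthogonal frames of rational spaces\<close>

text \<open>A rational quadratic space realized inside a real inner product space: positive
  definiteness is built in, while closure is required over the rationals only.\<close>

definition rational_space :: "'a::real_inner set \<Rightarrow> bool" where
  "rational_space V \<longleftrightarrow> 0 \<in> V \<and> (\<forall>x\<in>V. \<forall>y\<in>V. x + y \<in> V) \<and>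
     (\<forall>q\<in>\<rat>. \<forall>x\<in>V. q *\<^sub>R x \<in> V) \<and> (\<forall>x\<in>V. \<forall>y\<in>V. x \<bullet> y \<in> \<rat>)"

lemma rational_spaceD:
  assumes "rational_space V"
  shows "0 \<in> V" "x \<in> V \<Longrightarrow> y \<in> V \<Longrightarrow> x + y \<in> V" "q \<in> \<rat> \<Longrightarrow> x \<in> V \<Longrightarrow> q *\<^sub>R x \<in> V"
    "x \<in> V \<Longrightarrow> y \<in> V \<Longrightarrow> x \<bullet> y \<in> \<rat>"
  using assms unfolding rational_space_def by auto

lemma rational_space_diff:
  assumes "rational_space V" "x \<in> V" "y \<in> V"
  shows "x - y \<in> V"
  using rational_spaceD(2)[OF assms(1,2), of "(-1) *\<^sub>R y"] rational_spaceD(3)[OF assms(1) _ assms(3), of "-1"]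
  by simp

lemma rational_space_sum:
  assumes "rational_space V" "\<And>i. i \<in> A \<Longrightarrow> f i \<in> V"
  shows "sum f A \<in> V"
  using assms(2)
  by (induction A rule: infinite_finite_induct) (auto intro: rational_spaceD[OF assms(1)])

lemma rational_space_orthogonal:
  "rational_space V \<Longrightarrow> rational_space {x \<in> V. x \<bullet> y = 0}"
  unfolding rational_space_def by (auto simp: inner_add_left)

text \<open>Completeness is a trivial orthogonal complement within \<open>V\<close> instead of a
  spanning condition; in this form it passes at once to the complement of a member and back.\<close>

definition orthogonal_frame :: "'a::real_inner set \<Rightarrow> 'a set \<Rightarrow> bool" where
  "orthogonal_frame V S \<longleftrightarrow> finite S \<and> S \<subseteq> V \<and> 0 \<notin> S \<and> pairwise orthogonal S \<and>
     (\<forall>x\<in>V. (\<forall>s\<in>S. x \<bullet> s = 0) \<longrightarrow> x = 0)"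

lemma orthogonal_frame_remove:
  assumes "orthogonal_frame V S" "y \<in> S"
  shows "orthogonal_frame {x \<in> V. x \<bullet> y = 0} (S - {y})"
  using assms unfolding orthogonal_frame_def pairwise_def orthogonal_def by auto

lemma orthogonal_frame_insert:
  assumes "orthogonal_frame {x \<in> V. x \<bullet> y = 0} S" "y \<in> V" "y \<noteq> 0"
  shows "orthogonal_frame V (insert y S)" and "y \<notin> S"
  using assms unfolding orthogonal_frame_def pairwise_def orthogonal_def
  by (auto simp: inner_commute)

text \<open>The difference of the two sides is orthogonal to all of \<open>S\<close>, hence zero by
  completeness.\<close>

lemma orthogonal_frame_expansion:
  assumes V: "rational_space V" and S: "orthogonal_frame V S" and x: "x \<in> V"
  shows "x = (\<Sum>s\<in>S. (x \<bullet> s / (s \<bullet> s)) *\<^sub>R s)"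
proof -
  define d where "d = x - (\<Sum>s\<in>S. (x \<bullet> s / (s \<bullet> s)) *\<^sub>R s)"
  have fin: "finite S" and sub: "S \<subseteq> V" using S by (auto simp: orthogonal_frame_def)
  have "d \<in> V"
    unfolding d_def using x sub rational_spaceD(3,4)[OF V]
    by (intro rational_space_diff[OF V] rational_space_sum[OF V]) (auto simp: subset_iff)
  moreover have "d \<bullet> s = 0" if s: "s \<in> S" for s
  proof -
    have "(\<Sum>t\<in>S. (x \<bullet> t / (t \<bullet> t)) *\<^sub>R t) \<bullet> s = (\<Sum>t\<in>S. (x \<bullet> t / (t \<bullet> t)) * (t \<bullet> s))"
      by (simp add: inner_sum_left)
    also have "\<dots> = (\<Sum>t\<in>S. if t = s then x \<bullet> s else 0)"
      using S s by (intro sum.cong) (auto simp: orthogonal_frame_def pairwise_def orthogonal_def)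
    also have "\<dots> = x \<bullet> s" using fin s by simp
    finally show ?thesis by (simp add: d_def inner_diff_left)
  qed
  ultimately have "d = 0" using S by (auto simp: orthogonal_frame_def)
  then show ?thesis by (simp add: d_def)
qed

section \<open>Changing orthogonal frames one plane at a time\<close>

text \<open>\<open>s1\<close> and \<open>s2\<close> are replaced by the projection \<open>p\<close>
  of \<open>y\<close> to their plane and a vector \<open>q\<close> of that plane perpendicular to
  \<open>p\<close>. Then \<open>q\<close> is orthogonal to \<open>y\<close> too, so fewer frame
  vectors pair nontrivially with \<open>y\<close>.\<close>

lemma orthogonal_frame_exchange_plane:
  assumes V: "rational_space V" and S: "orthogonal_frame V S" and y: "y \<in> V"
    and s: "s1 \<in> S" "s2 \<in> S" "s1 \<noteq> s2" "y \<bullet> s1 \<noteq> 0" "y \<bullet> s2 \<noteq> 0"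
  shows "\<exists>S'. orthogonal_frame V S' \<and>
    (\<Sum>s\<in>S'. oddity_term (s \<bullet> s)) mod 8 = (\<Sum>s\<in>S. oddity_term (s \<bullet> s)) mod 8 \<and>
    card {s \<in> S'. y \<bullet> s \<noteq> 0} < card {s \<in> S. y \<bullet> s \<noteq> 0}"
proof -
  define a where "a = s1 \<bullet> s1"
  define b where "b = s2 \<bullet> s2"
  define g where "g = (y \<bullet> s1) / a"
  define h where "h = (y \<bullet> s2) / b"
  define p where "p = g *\<^sub>R s1 + h *\<^sub>R s2"
  \<comment> \<open>This scaling gives \<open>q \<bullet> q = a * b * (p \<bullet> p)\<close>. Up to
    the square of \<open>g * h\<close> this is the second entry that \<open>oddity_term_add\<close>
    yields for the entries \<open>g\<^sup>2 * a\<close> and \<open>h\<^sup>2 * b\<close>.\<close>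
  define q where "q = (b * h) *\<^sub>R s1 - (a * g) *\<^sub>R s2"
  define R where "R = S - {s1, s2}"
  have fin: "finite S" and SV: "S \<subseteq> V" and nz: "0 \<notin> S" and orth: "pairwise orthogonal S"
    and complete: "\<And>x. x \<in> V \<Longrightarrow> (\<forall>s\<in>S. x \<bullet> s = 0) \<Longrightarrow> x = 0"
    using S by (auto simp: orthogonal_frame_def)
  have s12: "s1 \<bullet> s2 = 0" "s2 \<bullet> s1 = 0"
    using orth s by (auto simp: pairwise_def orthogonal_def)
  have ab: "a > 0" "b > 0" unfolding a_def b_def using s nz by (metis inner_gt_zero_iff)+
  have gh: "g \<noteq> 0" "h \<noteq> 0" using s ab by (simp_all add: g_def h_def)
  have rat: "a \<in> \<rat>" "b \<in> \<rat>" "g \<in> \<rat>" "h \<in> \<rat>"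
    unfolding a_def b_def g_def h_def using s y SV by (auto intro!: Rats_divide rational_spaceD[OF V])
  have pq: "p \<bullet> q = 0"
    by (simp add: p_def q_def inner_diff_right inner_add_left s12 flip: a_def b_def)
  have pp: "p \<bullet> p = g\<^sup>2 * a + h\<^sup>2 * b"
    by (simp add: p_def inner_add_right inner_add_left s12 power2_eq_square mult.assoc flip: a_def b_def)
  have qq: "q \<bullet> q = a * b * (p \<bullet> p)"
    unfolding pp
    by (simp add: q_def inner_diff_right inner_diff_left s12 flip: a_def b_def) algebra
  have pp0: "p \<bullet> p > 0" unfolding pp using ab gh by (simp add: add_pos_pos)
  then have qq0: "q \<bullet> q > 0" unfolding qq using ab by simp
  have yp: "y \<bullet> q = 0"
    using ab by (simp add: q_def inner_diff_right g_def h_def)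
  have Rp: "r \<bullet> p = 0" "r \<bullet> q = 0" if "r \<in> R" for r
  proof -
    have "r \<bullet> s1 = 0" "r \<bullet> s2 = 0"
      using that orth s by (auto simp: R_def pairwise_def orthogonal_def)
    then show "r \<bullet> p = 0" "r \<bullet> q = 0" by (simp_all add: p_def q_def inner_add_right inner_diff_right)
  qed
  have pqV: "p \<in> V" "q \<in> V"
    unfolding p_def q_def using s SV rat
    by (auto intro!: rational_spaceD[OF V] rational_space_diff[OF V])
  have notin: "p \<notin> R" "q \<notin> R" "p \<noteq> q"
    using Rp pp0 qq0 pq by (metis less_irrefl)+
  have finR: "finite R" using fin by (simp add: R_def)
  have S_eq: "S = insert s1 (insert s2 R)" "s1 \<notin> insert s2 R" "s2 \<notin> R"
    using s by (auto simp: R_def)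
  have "orthogonal_frame V (insert p (insert q R))"
    unfolding orthogonal_frame_def
  proof (intro conjI ballI impI)
    show "finite (insert p (insert q R))" using finR by simp
    show "insert p (insert q R) \<subseteq> V" using pqV SV by (auto simp: R_def)
    show "0 \<notin> insert p (insert q R)" using pp0 qq0 nz by (auto simp: R_def)
    show "pairwise orthogonal (insert p (insert q R))"
      unfolding pairwise_insert orthogonal_def using pq Rp pairwise_subset[OF orth, of R]
      by (auto simp: inner_commute R_def pairwise_def orthogonal_def)
  next
    fix x assume x: "x \<in> V" "\<forall>s\<in>insert p (insert q R). x \<bullet> s = 0"
    then have e: "g * (x \<bullet> s1) + h * (x \<bullet> s2) = 0" "b * h * (x \<bullet> s1) - a * g * (x \<bullet> s2) = 0"
      by (simp_all add: p_def q_def inner_add_right inner_diff_right)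
    \<comment> \<open>The two equations are a linear system with determinant
      \<open>- (p \<bullet> p)\<close>, which is nonzero.\<close>
    have "(p \<bullet> p) * (x \<bullet> s1) = 0" "(p \<bullet> p) * (x \<bullet> s2) = 0"
      unfolding pp using e by algebra+
    then have "x \<bullet> s1 = 0" "x \<bullet> s2 = 0" using pp0 by auto
    with x show "x = 0" by (intro complete) (auto simp: S_eq)
  qed
  moreover have "(\<Sum>s\<in>insert p (insert q R). oddity_term (s \<bullet> s)) mod 8 =
    (\<Sum>s\<in>S. oddity_term (s \<bullet> s)) mod 8"
  proof -
    have "(oddity_term (g\<^sup>2 * a) + oddity_term (h\<^sup>2 * b)) mod 8 =
      (oddity_term (p \<bullet> p) + oddity_term (g\<^sup>2 * a * (h\<^sup>2 * b) * (p \<bullet> p))) mod 8"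
      using oddity_term_add[of "g\<^sup>2 * a" "h\<^sup>2 * b"] rat gh ab pp pp0 by simp
    also have "g\<^sup>2 * a * (h\<^sup>2 * b) * (p \<bullet> p) = (g * h)\<^sup>2 * (q \<bullet> q)"
      unfolding qq by algebra
    also have "oddity_term \<dots> = oddity_term (q \<bullet> q)"
      using rat gh qq0 rational_spaceD(4)[OF V pqV(2) pqV(2)]
      by (intro oddity_term_mult_square) auto
    also have "oddity_term (g\<^sup>2 * a) = oddity_term a"
      using rat gh ab by (intro oddity_term_mult_square) auto
    also have "oddity_term (h\<^sup>2 * b) = oddity_term b"
      using rat gh ab by (intro oddity_term_mult_square) auto
    finally have "(oddity_term (p \<bullet> p) + oddity_term (q \<bullet> q)) mod 8 = (oddity_term a + oddity_term b) mod 8"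
      by simp
    then have "(oddity_term (p \<bullet> p) + oddity_term (q \<bullet> q) + (\<Sum>s\<in>R. oddity_term (s \<bullet> s))) mod 8 =
      (oddity_term a + oddity_term b + (\<Sum>s\<in>R. oddity_term (s \<bullet> s))) mod 8"
      by (rule mod_add_cong) simp
    then show ?thesis
      using notin S_eq(2,3) finR unfolding S_eq(1) by (simp add: a_def b_def add.assoc)
  qed
  moreover have "card {s \<in> insert p (insert q R). y \<bullet> s \<noteq> 0} < card {s \<in> S. y \<bullet> s \<noteq> 0}"
  proof -
    have "card {s \<in> insert p (insert q R). y \<bullet> s \<noteq> 0} \<le> card (insert p {s \<in> R. y \<bullet> s \<noteq> 0})"
      using yp finR by (intro card_mono) auto
    also have "\<dots> \<le> Suc (card {s \<in> R. y \<bullet> s \<noteq> 0})" by (rule card_insert_le_m1) auto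
    also have "\<dots> < Suc (Suc (card {s \<in> R. y \<bullet> s \<noteq> 0}))" by simp
    also have "\<dots> = card {s \<in> S. y \<bullet> s \<noteq> 0}"
    proof -
      have "{s \<in> S. y \<bullet> s \<noteq> 0} = insert s1 (insert s2 {s \<in> R. y \<bullet> s \<noteq> 0})"
        using s by (auto simp: S_eq(1))
      then show ?thesis using finR S_eq(2,3) by simp
    qed
    finally show ?thesis .
  qed
  ultimately show ?thesis by blast
qed

text \<open>Induction on the number of frame vectors not orthogonal to \<open>y\<close>. Once a
  single one is left, \<open>y\<close> is a rational multiple of it and takes its place, which
  changes the norm by a square.\<close>

lemma orthogonal_frame_exchange:
  assumes V: "rational_space V" and y: "y \<in> V" "y \<noteq> 0" and "orthogonal_frame V S"
  shows "\<exists>S'. orthogonal_frame V S' \<and> y \<in> S' \<and>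
    (\<Sum>s\<in>S'. oddity_term (s \<bullet> s)) mod 8 = (\<Sum>s\<in>S. oddity_term (s \<bullet> s)) mod 8"
  using assms(4)
proof (induction "card {s \<in> S. y \<bullet> s \<noteq> 0}" arbitrary: S rule: less_induct)
  case less
  note S = \<open>orthogonal_frame V S\<close>
  obtain s1 where s1: "s1 \<in> S" "y \<bullet> s1 \<noteq> 0"
    using S y unfolding orthogonal_frame_def by blast
  show ?case
  proof (cases "\<exists>s2\<in>S. s2 \<noteq> s1 \<and> y \<bullet> s2 \<noteq> 0")
    case True
    then obtain s2 where s2: "s2 \<in> S" "s1 \<noteq> s2" "y \<bullet> s2 \<noteq> 0" by auto
    obtain T where T: "orthogonal_frame V T"
      "(\<Sum>s\<in>T. oddity_term (s \<bullet> s)) mod 8 = (\<Sum>s\<in>S. oddity_term (s \<bullet> s)) mod 8"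
      "card {s \<in> T. y \<bullet> s \<noteq> 0} < card {s \<in> S. y \<bullet> s \<noteq> 0}"
      using orthogonal_frame_exchange_plane[OF V S y(1) s1(1) s2(1,2) s1(2) s2(3)] by blast
    from less.hyps[OF T(3,1)] T(2) show ?thesis by metis
  next
    case False
    define r where "r = y \<bullet> s1 / (s1 \<bullet> s1)"
    have S': "finite S" "S \<subseteq> V" "0 \<notin> S" "pairwise orthogonal S" using S by (auto simp: orthogonal_frame_def)
    have s10: "s1 \<noteq> 0" using s1 by auto
    \<comment> \<open>Only \<open>s1\<close> pairs nontrivially with \<open>y\<close>, so the
      expansion of \<open>y\<close> has a single term.\<close>
    have "y = (\<Sum>s\<in>S. if s = s1 then r *\<^sub>R s1 else 0)"
      by (subst orthogonal_frame_expansion[OF V S y(1)], rule sum.cong) (use False in \<open>auto simp: r_def\<close>)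
    then have yr: "y = r *\<^sub>R s1" using s1 S' by simp
    have r: "r \<noteq> 0" "r \<in> \<rat>"
      using y(1) s1 s10 S'(2) rational_spaceD(4)[OF V] by (auto simp: r_def intro!: Rats_divide)
    have fr: "orthogonal_frame {x \<in> V. x \<bullet> y = 0} (S - {s1})"
      using orthogonal_frame_remove[OF S s1(1)] r(1) unfolding arg_cong[OF yr, of "\<lambda>y. x \<bullet> y" for x]
      by simp
    have y': "y \<notin> S - {s1}" "orthogonal_frame V (insert y (S - {s1}))"
      using orthogonal_frame_insert[OF fr y] by auto
    have "y \<bullet> y = r\<^sup>2 * (s1 \<bullet> s1)"
      by (subst (1 2) yr) (simp add: power2_eq_square)
    then have "oddity_term (y \<bullet> y) = oddity_term (s1 \<bullet> s1)"
      using r s10 rational_spaceD(4)[OF V] s1 S' by (simp only:) (rule oddity_term_mult_square; auto)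
    then have "(\<Sum>s\<in>insert y (S - {s1}). oddity_term (s \<bullet> s)) = (\<Sum>s\<in>S. oddity_term (s \<bullet> s))"
      using S'(1) y'(1) s1(1) by (simp add: sum.remove)
    then show ?thesis using y'(2) by (intro exI[of _ "insert y (S - {s1})"]) simp
  qed
qed

text \<open>A member \<open>y\<close> of \<open>S'\<close> is moved into the other frame; its term
  then cancels, and the induction continues in the orthogonal complement of
  \<open>y\<close>.\<close>

lemma sum_oddity_term_orthogonal_frame:
  assumes "rational_space V" "orthogonal_frame V S" "orthogonal_frame V S'"
  shows "(\<Sum>s\<in>S. oddity_term (s \<bullet> s)) mod 8 = (\<Sum>s\<in>S'. oddity_term (s \<bullet> s)) mod 8"
  using assms
proof (induction "card S'" arbitrary: V S S')
  case 0
  then have "S' = {}" by (auto simp: orthogonal_frame_def)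
  \<comment> \<open>An empty complete frame forces \<open>V\<close> to be zero, so that
    \<open>S\<close> is empty as well.\<close>
  then have "V \<subseteq> {0}" using 0 by (auto simp: orthogonal_frame_def)
  then have "S = {}" using 0 by (auto simp: orthogonal_frame_def)
  then show ?case using \<open>S' = {}\<close> by simp
next
  case (Suc n)
  have fin: "finite S'" using Suc by (auto simp: orthogonal_frame_def)
  obtain y where y: "y \<in> S'" using Suc.hyps(2) by fastforce
  then have yV: "y \<in> V" "y \<noteq> 0" using Suc.prems by (auto simp: orthogonal_frame_def)
  obtain T where T: "orthogonal_frame V T" "y \<in> T"
    "(\<Sum>s\<in>T. oddity_term (s \<bullet> s)) mod 8 = (\<Sum>s\<in>S. oddity_term (s \<bullet> s)) mod 8"
    using orthogonal_frame_exchange[OF Suc.prems(1) yV Suc.prems(2)] by blast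
  have finT: "finite T" using T by (auto simp: orthogonal_frame_def)
  have "(\<Sum>s\<in>T - {y}. oddity_term (s \<bullet> s)) mod 8 = (\<Sum>s\<in>S' - {y}. oddity_term (s \<bullet> s)) mod 8"
    using Suc.hyps(2) y fin
    by (intro Suc.hyps(1)[OF _ rational_space_orthogonal[OF Suc.prems(1)]
          orthogonal_frame_remove[OF T(1,2)] orthogonal_frame_remove[OF Suc.prems(3) y]]) simp
  then have "(oddity_term (y \<bullet> y) + (\<Sum>s\<in>T - {y}. oddity_term (s \<bullet> s))) mod 8 =
    (oddity_term (y \<bullet> y) + (\<Sum>s\<in>S' - {y}. oddity_term (s \<bullet> s))) mod 8"
    by (rule mod_add_cong[OF refl])
  then show ?case
    using T(3) sum.remove[OF finT T(2), of "\<lambda>s. oddity_term (s \<bullet> s)"]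
      sum.remove[OF fin y, of "\<lambda>s. oddity_term (s \<bullet> s)"] by simp
qed

section \<open>Characteristic vectors of lattices unimodular at 2\<close>

text \<open>
  As every \<open>M\<close> with this property is a module over the local ring at 2, no lattice
  structure is required; \<open>V\<close> plays the role of \<open>M \<otimes> \<rat>\<close>.
\<close>
definition two_unimodular :: "'a::real_inner set \<Rightarrow> 'a set \<Rightarrow> bool" where
  "two_unimodular V M \<longleftrightarrow> M = {x \<in> V. \<forall>u\<in>M. x \<bullet> u \<in> padic_ints 2}"

definition characteristic_vector :: "'a::real_inner set \<Rightarrow> 'a \<Rightarrow> bool" where
  "characteristic_vector M c \<longleftrightarrow> c \<in> M \<and> (\<forall>x\<in>M. two_adic_cong (c \<bullet> x) (x \<bullet> x) 2)"

lemma two_unimodularD: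
  assumes "two_unimodular V M"
  shows "x \<in> M \<Longrightarrow> x \<in> V" "x \<in> M \<Longrightarrow> y \<in> M \<Longrightarrow> x \<bullet> y \<in> padic_ints 2"
    "x \<in> V \<Longrightarrow> (\<And>u. u \<in> M \<Longrightarrow> x \<bullet> u \<in> padic_ints 2) \<Longrightarrow> x \<in> M"
  using assms unfolding two_unimodular_def by blast+

text \<open>Self-duality cuts \<open>M\<close> out of \<open>V\<close> by integrality conditions,
  and these are inherited by differences and by multiples from the local ring.\<close>

lemma two_unimodular_closed:
  assumes "rational_space V" "two_unimodular V M" "x \<in> M" "y \<in> M"
  shows "x - y \<in> M" "a \<in> padic_ints 2 \<Longrightarrow> a *\<^sub>R x \<in> M"
proof -
  show "x - y \<in> M"
    using two_unimodularD[OF assms(2)] assms(3,4)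
    by (auto intro!: two_unimodularD(3)[OF assms(2)] rational_space_diff[OF assms(1)]
        padic_ints_two_diff simp: inner_diff_left)
  show "a *\<^sub>R x \<in> M" if "a \<in> padic_ints 2"
    using two_unimodularD[OF assms(2)] assms(3) that padic_ints_two_Rats[OF that]
    by (auto intro!: two_unimodularD(3)[OF assms(2)] rational_spaceD[OF assms(1)] padic_ints_two_mult)
qed

text \<open>A vector of \<open>V'\<close> sees only the projection \<open>y'\<close> of
  \<open>y\<close>. Integrality against \<open>M \<inter> V'\<close> is therefore integrality
  against all of \<open>M\<close>, and self-duality of \<open>M\<close> applies.\<close>

lemma two_unimodular_orthogonal_summand:
  assumes M: "two_unimodular V M" and sub: "V' \<subseteq> V"
    and proj: "\<And>y. y \<in> M \<Longrightarrow> \<exists>y'\<in>M \<inter> V'. \<forall>x\<in>V'. x \<bullet> y = x \<bullet> y'"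
  shows "two_unimodular V' (M \<inter> V')"
  unfolding two_unimodular_def
proof (intro equalityI subsetI)
  fix x assume "x \<in> M \<inter> V'"
  then show "x \<in> {x \<in> V'. \<forall>u\<in>M \<inter> V'. x \<bullet> u \<in> padic_ints 2}"
    using two_unimodularD(2)[OF M] by auto
next
  fix x assume x: "x \<in> {x \<in> V'. \<forall>u\<in>M \<inter> V'. x \<bullet> u \<in> padic_ints 2}"
  have "x \<in> M"
  proof (rule two_unimodularD(3)[OF M])
    show "x \<in> V" using x sub by auto
    fix y assume "y \<in> M"
    with proj obtain y' where "y' \<in> M \<inter> V'" "\<forall>x\<in>V'. x \<bullet> y = x \<bullet> y'" by blast
    with x show "x \<bullet> y \<in> padic_ints 2" by auto
  qed
  with x show "x \<in> M \<inter> V'" by auto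
qed

text \<open>Makes the induction below terminate: the real span of \<open>V'\<close> stays in the
  hyperplane orthogonal to \<open>u\<close>, which does not contain \<open>u\<close>.\<close>

lemma dim_orthogonal_less:
  fixes u :: "'a::euclidean_space"
  assumes "u \<in> V" "u \<noteq> 0" "V' \<subseteq> {x \<in> V. x \<bullet> u = 0}"
  shows "dim V' < dim V"
proof (rule dim_psubset)
  have "subspace {x. x \<bullet> u = 0}"
    by (auto simp: subspace_def inner_add_left)
  then have "span V' \<subseteq> {x. x \<bullet> u = 0}"
    using assms(3) by (intro span_minimal) auto
  then have "u \<notin> span V'" using assms(2) by auto
  moreover have "u \<in> span V" using assms(1) by (rule span_base)
  moreover have "span V' \<subseteq> span V" using assms(3) by (intro span_mono) auto
  ultimately show "span V' \<subset> span V" by blast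
qed

text \<open>Induction on the dimension of the real span. The frame depends only on \<open>V\<close>
  and \<open>M\<close>, not on \<open>c\<close>, and its existence is part of the conclusion because
  it later provides a diagonalization of the whole space.\<close>

lemma characteristic_vector_norm:
  fixes V :: "'a::euclidean_space set"
  assumes "rational_space V" "two_unimodular V M"
  shows "\<exists>S. orthogonal_frame V S \<and> (\<forall>c. characteristic_vector M c \<longrightarrow>
    two_adic_cong (c \<bullet> c) (of_int (\<Sum>s\<in>S. oddity_term (s \<bullet> s))) 8)"
  using assms
proof (induction "dim V" arbitrary: V M rule: less_induct)
  case less
  note V = \<open>rational_space V\<close> and M = \<open>two_unimodular V M\<close>
  note MD = two_unimodularD[OF M] and closed = two_unimodular_closed[OF V M]
  show ?case
  proof (cases "\<exists>u\<in>M. two_adic_unit (u \<bullet> u)")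
    case True
    then obtain u where u: "u \<in> M" "two_adic_unit (u \<bullet> u)" by blast
    define n where "n = u \<bullet> u"
    have n: "two_adic_unit n" using u by (simp add: n_def)
    then have n0: "n \<noteq> 0" by (simp add: two_adic_unit_def)
    then have u0: "u \<noteq> 0" by (auto simp: n_def)
    define V' where "V' = {x \<in> V. x \<bullet> u = 0}"
    define proj where "proj y = y - (y \<bullet> u / n) *\<^sub>R u" for y
    \<comment> \<open>Since \<open>n\<close> is a unit, the projection coefficient is integral and
      projecting does not leave \<open>M\<close>.\<close>
    have coeff: "y \<bullet> u / n \<in> padic_ints 2" if "y \<in> M" for y
      using MD(2)[OF that u(1)] n by (rule two_adic_unit_divide)
    have projM: "proj y \<in> M \<inter> V'" if "y \<in> M" for y
    proof
      show "proj y \<in> M"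
        unfolding proj_def using that u coeff closed by blast
      then show "proj y \<in> V'"
        using MD(1) n0 by (auto simp: V'_def proj_def inner_diff_left n_def)
    qed
    have inner_proj: "x \<bullet> y = x \<bullet> proj y" if "x \<in> V'" for x y
      using that by (simp add: V'_def proj_def inner_diff_right)
    have M': "two_unimodular V' (M \<inter> V')"
    proof (rule two_unimodular_orthogonal_summand[OF M])
      show "V' \<subseteq> V" by (auto simp: V'_def)
      show "\<exists>y'\<in>M \<inter> V'. \<forall>x\<in>V'. x \<bullet> y = x \<bullet> y'" if "y \<in> M" for y
        using projM[OF that] inner_proj by blast
    qed
    have "dim V' < dim V"
      using u u0 MD(1) by (intro dim_orthogonal_less[of u]) (auto simp: V'_def)
    moreover have "rational_space V'"
      unfolding V'_def by (rule rational_space_orthogonal[OF V])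
    ultimately obtain S where S: "orthogonal_frame V' S"
      "\<And>c. characteristic_vector (M \<inter> V') c \<Longrightarrow>
        two_adic_cong (c \<bullet> c) (of_int (\<Sum>s\<in>S. oddity_term (s \<bullet> s))) 8"
      using less.hyps[OF _ _ M'] by blast
    have uV: "u \<in> V" using u MD(1) by blast
    note ins = orthogonal_frame_insert[OF S(1)[unfolded V'_def] uV u0]
    have "two_adic_cong (c \<bullet> c) (of_int (\<Sum>s\<in>insert u S. oddity_term (s \<bullet> s))) 8"
      if c: "characteristic_vector M c" for c
    proof -
      define g where "g = c \<bullet> u / n"
      have cM: "c \<in> M" and ch: "\<And>x. x \<in> M \<Longrightarrow> (c \<bullet> x - x \<bullet> x) / 2 \<in> padic_ints 2"
        using c by (auto simp: characteristic_vector_def two_adic_cong_iff)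
      have "characteristic_vector (M \<inter> V') (proj c)"
        unfolding characteristic_vector_def
      proof (intro conjI ballI)
        show "proj c \<in> M \<inter> V'" by (rule projM[OF cM])
        fix x assume x: "x \<in> M \<inter> V'"
        have "proj c \<bullet> x = c \<bullet> x"
          using inner_proj[of x c] x by (simp add: inner_commute)
        then show "two_adic_cong (proj c \<bullet> x) (x \<bullet> x) 2"
          using c x by (simp add: characteristic_vector_def)
      qed
      note c' = S(2)[OF this]
      \<comment> \<open>The characteristic congruence at \<open>u\<close> gives
        \<open>c \<bullet> u\<close> the same parity as the odd norm \<open>n\<close>.\<close>
      have "two_adic_unit (c \<bullet> u)"
      proof -
        have "c \<bullet> u / 2 \<notin> padic_ints 2"
        proof
          assume "c \<bullet> u / 2 \<in> padic_ints 2"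
          then have "c \<bullet> u / 2 - (c \<bullet> u - u \<bullet> u) / 2 \<in> padic_ints 2"
            using ch[OF u(1)] by (rule padic_ints_two_diff)
          then have "n / 2 \<in> padic_ints 2" by (simp add: n_def field_simps)
          then show False using n by (simp add: two_adic_unit_iff_half)
        qed
        then show ?thesis using MD(2)[OF cM u(1)] by (simp add: two_adic_unit_iff_half)
      qed
      moreover have "two_adic_unit (inverse n)" using n by (simp add: two_adic_unit_def)
      ultimately have "two_adic_unit g"
        unfolding g_def divide_inverse by (rule two_adic_unit_mult)
      then have "(g\<^sup>2 - 1) / 8 * n \<in> padic_ints 2"
        using n by (intro padic_ints_two_mult two_adic_unit_square_cong) (auto simp: two_adic_unit_def)
      then have "two_adic_cong (g\<^sup>2 * n) n 8"
        by (simp add: two_adic_cong_iff field_simps)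
      then have "two_adic_cong (g\<^sup>2 * n) (of_int (oddity_term n)) 8"
        using oddity_term_unit_cong[OF n] by (rule two_adic_cong_trans)
      from two_adic_cong_add[OF this c']
      have "two_adic_cong (g\<^sup>2 * n + proj c \<bullet> proj c)
        (of_int (oddity_term n) + of_int (\<Sum>s\<in>S. oddity_term (s \<bullet> s))) 8" .
      moreover have "c \<bullet> c = g\<^sup>2 * n + proj c \<bullet> proj c"
      proof -
        have "proj c \<bullet> u = 0" using projM[OF cM] by (simp add: V'_def)
        moreover have "c = proj c + g *\<^sub>R u" by (simp add: proj_def g_def)
        then have "c \<bullet> c = (proj c + g *\<^sub>R u) \<bullet> (proj c + g *\<^sub>R u)" by simp
        ultimately show ?thesis
          by (simp add: inner_add_left inner_add_right inner_commute n_def power2_eq_square)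
      qed
      moreover have "finite S" using S(1) by (simp add: orthogonal_frame_def)
      ultimately show ?thesis
        using ins(2) by (simp add: n_def)
    qed
    then show ?thesis using ins(1) by blast
  next
    case False
    then have even: "x \<bullet> x / 2 \<in> padic_ints 2" if "x \<in> M" for x
      using that MD(2)[OF that that] padic_ints_two_unit_or_even by blast
    \<comment> \<open>With all norms even, the characteristic condition says that \<open>c\<close>
      has even products with all of \<open>M\<close>.\<close>
    have ch: "c \<bullet> x / 2 \<in> padic_ints 2" if "characteristic_vector M c" "x \<in> M" for c x
    proof -
      have "(c \<bullet> x - x \<bullet> x) / 2 \<in> padic_ints 2"
        using that by (auto simp: characteristic_vector_def two_adic_cong_iff)
      from padic_ints_two_add[OF this even[OF that(2)]] show ?thesis
        by (simp add: field_simps)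
    qed
    show ?thesis
    proof (cases "M \<subseteq> {0}")
      case True
      then have "V \<subseteq> {0}" using MD(3) by (metis inner_zero_right padic_ints_two_zero singletonD subset_iff)
      then have "orthogonal_frame V {}" by (auto simp: orthogonal_frame_def)
      moreover have "two_adic_cong (c \<bullet> c) 0 8" if "characteristic_vector M c" for c
        using that True by (auto simp: characteristic_vector_def)
      ultimately show ?thesis by (intro exI[of _ "{}"]) auto
    next
      case False
      \<comment> \<open>Otherwise a nonzero \<open>u\<close> could be halved forever within
        \<open>M\<close>, making \<open>u \<bullet> u / 4 ^ k\<close> integral for every
        \<open>k\<close>.\<close>
      have "\<exists>u\<in>M. (1 / 2) *\<^sub>R u \<notin> M"
      proof (rule ccontr)
        assume "\<not> ?thesis"
        then have half: "(1 / 2) *\<^sub>R u \<in> M" if "u \<in> M" for u using that by blast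
        obtain u where u: "u \<in> M" "u \<noteq> 0" using False by blast
        have pow: "(1 / 2 ^ k) *\<^sub>R u \<in> M" for k
        proof (induction k)
          case (Suc k)
          then show ?case using half by fastforce
        qed (use u in simp)
        have "u \<bullet> u / 4 ^ k \<in> padic_ints 2" for k
          using MD(2)[OF pow[of k] pow[of k]] by (simp flip: power_mult_distrib)
        moreover have "u \<bullet> u \<noteq> 0" using u by simp
        ultimately show False
          using padic_ints_two_not_infinitely_divisible MD(2)[OF u(1) u(1)] by blast
      qed
      then obtain u where u: "u \<in> M" "(1 / 2) *\<^sub>R u \<notin> M" by blast
      have "(1 / 2) *\<^sub>R u \<in> V" using MD(1) u by (intro rational_spaceD[OF V]) auto
      \<comment> \<open>By self-duality, the failure of \<open>u / 2\<close> to lie in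
        \<open>M\<close> is witnessed by some \<open>w\<close> with odd
        \<open>u \<bullet> w\<close>.\<close>
      then obtain w where w: "w \<in> M" "u \<bullet> w / 2 \<notin> padic_ints 2"
        using u(2) MD(3)[of "(1 / 2) *\<^sub>R u"] by auto
      define x where "x = u \<bullet> u"
      define y where "y = w \<bullet> w"
      define b where "b = u \<bullet> w"
      define D where "D = x * y - b\<^sup>2"
      have b: "two_adic_unit b"
        using MD(2)[OF u(1) w(1)] w(2) by (simp add: two_adic_unit_iff_half b_def)
      have xy: "x / 2 \<in> padic_ints 2" "y / 2 \<in> padic_ints 2" "x \<in> padic_ints 2" "y \<in> padic_ints 2"
        "b \<in> padic_ints 2"
        using even u w MD(2) by (simp_all add: x_def y_def b_def)
      have D: "two_adic_unit D"
      proof -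
        have "D / 2 \<notin> padic_ints 2"
        proof
          assume "D / 2 \<in> padic_ints 2"
          then have "x / 2 * y - D / 2 \<in> padic_ints 2"
            using xy by (intro padic_ints_two_diff padic_ints_two_mult)
          then have "b * b / 2 \<in> padic_ints 2"
            by (simp add: D_def power2_eq_square field_simps)
          then show False using two_adic_unit_mult[OF b b] by (simp add: two_adic_unit_iff_half)
        qed
        moreover have "D \<in> padic_ints 2"
          unfolding D_def power2_eq_square using xy by (intro padic_ints_two_diff padic_ints_two_mult)
        ultimately show ?thesis by (simp add: two_adic_unit_iff_half)
      qed
      then have D0: "D \<noteq> 0" by (simp add: two_adic_unit_def)
      have "b \<noteq> 0" using b by (simp add: two_adic_unit_def)
      then have u0: "u \<noteq> 0" by (auto simp: b_def)
      then have x0: "x \<noteq> 0" by (simp add: x_def)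
      \<comment> \<open>The coefficient \<open>b / x\<close> is not integral at 2, as
        \<open>x\<close> is even. Thus \<open>w'\<close> serves only the frame of \<open>V\<close>,
        while the splitting of \<open>M\<close> uses \<open>u\<close> and \<open>w\<close>
        themselves.\<close>
      define w' where "w' = w - (b / x) *\<^sub>R u"
      have w'u: "w' \<bullet> u = 0"
        using u0 by (simp add: w'_def inner_diff_left b_def x_def inner_commute[of w u])
      have w'w': "w' \<bullet> w' = D / x"
      proof -
        have "w' \<bullet> w' = w' \<bullet> w"
          using w'u by (subst (2) w'_def) (simp add: inner_diff_right)
        also have "\<dots> = y - b / x * b" by (simp add: w'_def inner_diff_left b_def y_def)
        also have "\<dots> = D / x" using x0 by (simp add: D_def power2_eq_square field_simps)
        finally show ?thesis .
      qed
      then have w'0: "w' \<noteq> 0" using D0 x0 by auto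
      have uV: "u \<in> V" "w \<in> V" using u w MD(1) by auto
      have "w' \<in> V"
        unfolding w'_def b_def x_def using uV
        by (intro rational_space_diff[OF V] rational_spaceD(3)[OF V] Rats_divide rational_spaceD(4)[OF V])
      then have w'V: "w' \<in> {z \<in> V. z \<bullet> u = 0}" using w'u by simp
      \<comment> \<open>The nested complement matches two successive applications of
        \<open>orthogonal_frame_insert\<close>; \<open>V'_iff\<close> is the symmetric
        description.\<close>
      define V' where "V' = {z \<in> {z \<in> V. z \<bullet> u = 0}. z \<bullet> w' = 0}"
      have V'_iff: "z \<in> V' \<longleftrightarrow> z \<in> V \<and> z \<bullet> u = 0 \<and> z \<bullet> w = 0" for z
        by (auto simp: V'_def w'_def inner_diff_right)
      \<comment> \<open>\<open>f\<close> and \<open>g\<close> solve, by Cramer's rule, for the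
        coefficients of the projection to the plane of \<open>u\<close> and \<open>w\<close>. They
        are integral on \<open>M\<close> because the determinant \<open>D\<close> is a unit.\<close>
      define f where "f z = ((z \<bullet> u) * y - (z \<bullet> w) * b) / D" for z
      define g where "g z = ((z \<bullet> w) * x - (z \<bullet> u) * b) / D" for z
      define proj where "proj z = z - f z *\<^sub>R u - g z *\<^sub>R w" for z
      have coeff: "f z \<in> padic_ints 2" "g z \<in> padic_ints 2" if "z \<in> M" for z
        unfolding f_def g_def using that u w xy MD(2) D
        by (intro two_adic_unit_divide padic_ints_two_diff padic_ints_two_mult; blast)+
      have projM: "proj z \<in> M \<inter> V'" if "z \<in> M" for z
      proof
        show *: "proj z \<in> M"
          unfolding proj_def using that u(1) w(1) coeff[OF that] closed by meson
        have "f z * x + g z * b = z \<bullet> u"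
        proof -
          have "f z * x + g z * b = (((z \<bullet> u) * y - (z \<bullet> w) * b) * x + ((z \<bullet> w) * x - (z \<bullet> u) * b) * b) / D"
            by (simp add: f_def g_def add_divide_distrib)
          also have "\<dots> = (z \<bullet> u) * D / D"
            by (rule arg_cong[of _ _ "\<lambda>t. t / D"]) (simp add: D_def power2_eq_square algebra_simps)
          finally show ?thesis using D0 by simp
        qed
        moreover have "f z * b + g z * y = z \<bullet> w"
        proof -
          have "f z * b + g z * y = (((z \<bullet> u) * y - (z \<bullet> w) * b) * b + ((z \<bullet> w) * x - (z \<bullet> u) * b) * y) / D"
            by (simp add: f_def g_def add_divide_distrib)
          also have "\<dots> = (z \<bullet> w) * D / D"
            by (rule arg_cong[of _ _ "\<lambda>t. t / D"]) (simp add: D_def power2_eq_square algebra_simps)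
          finally show ?thesis using D0 by simp
        qed
        ultimately have "proj z \<bullet> u = 0" "proj z \<bullet> w = 0"
          by (simp_all add: proj_def inner_diff_left x_def y_def b_def inner_commute[of w u])
        then show "proj z \<in> V'" using * MD(1) by (simp add: V'_iff)
      qed
      have inner_proj: "z' \<bullet> z = z' \<bullet> proj z" if "z' \<in> V'" for z' z
        using that by (simp add: V'_iff proj_def inner_diff_right)
      have M': "two_unimodular V' (M \<inter> V')"
      proof (rule two_unimodular_orthogonal_summand[OF M])
        show "V' \<subseteq> V" by (auto simp: V'_def)
        show "\<exists>z'\<in>M \<inter> V'. \<forall>x\<in>V'. x \<bullet> z = x \<bullet> z'" if "z \<in> M" for z
          using projM[OF that] inner_proj by blast
      qed
      have "dim V' < dim V"
        using uV u0 by (intro dim_orthogonal_less[of u]) (auto simp: V'_def)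
      moreover have "rational_space V'"
        unfolding V'_def by (intro rational_space_orthogonal V)
      ultimately obtain S where S: "orthogonal_frame V' S"
        "\<And>c. characteristic_vector (M \<inter> V') c \<Longrightarrow>
          two_adic_cong (c \<bullet> c) (of_int (\<Sum>s\<in>S. oddity_term (s \<bullet> s))) 8"
        using less.hyps[OF _ _ M'] by blast
      note ins1 = orthogonal_frame_insert[OF S(1)[unfolded V'_def] w'V w'0]
      note ins2 = orthogonal_frame_insert[OF ins1(1) uV(1) u0]
      have finS: "finite S" using S(1) by (simp add: orthogonal_frame_def)
      have sum: "(\<Sum>s\<in>insert u (insert w' S). oddity_term (s \<bullet> s)) =
        oddity_term x + oddity_term (D / x) + (\<Sum>s\<in>S. oddity_term (s \<bullet> s))"
        using ins1(2) ins2(2) finS by (simp add: w'w' flip: x_def)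
      have "(oddity_term x + oddity_term (D / x)) mod 8 = 0"
        unfolding D_def using xy b x0 D0 by (intro oddity_term_even_plane) (simp_all add: D_def)
      then have sum_cong: "two_adic_cong (of_int (\<Sum>s\<in>S. oddity_term (s \<bullet> s)))
        (of_int (\<Sum>s\<in>insert u (insert w' S). oddity_term (s \<bullet> s))) (of_int 8)"
        unfolding sum by (intro two_adic_cong_of_int_mod) (metis add_0 mod_add_left_eq)
      have "two_adic_cong (c \<bullet> c) (of_int (\<Sum>s\<in>insert u (insert w' S). oddity_term (s \<bullet> s))) 8"
        if c: "characteristic_vector M c" for c
      proof -
        have cM: "c \<in> M" using c by (simp add: characteristic_vector_def)
        have "characteristic_vector (M \<inter> V') (proj c)"
          unfolding characteristic_vector_def
        proof (intro conjI ballI)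
          show "proj c \<in> M \<inter> V'" by (rule projM[OF cM])
          fix z assume z: "z \<in> M \<inter> V'"
          have "proj c \<bullet> z = c \<bullet> z"
            using inner_proj[of z c] z by (simp add: inner_commute)
          then show "two_adic_cong (proj c \<bullet> z) (z \<bullet> z) 2"
            using c z by (simp add: characteristic_vector_def)
        qed
        note c' = S(2)[OF this]
        have half: "f c / 2 \<in> padic_ints 2" "g c / 2 \<in> padic_ints 2"
        proof -
          have *: "(s / 2 * a - t / 2 * b) / D \<in> padic_ints 2"
            if "s / 2 \<in> padic_ints 2" "t / 2 \<in> padic_ints 2" "a \<in> padic_ints 2" for s t a
            by (rule two_adic_unit_divide[OF padic_ints_two_diff[OF padic_ints_two_mult[OF that(1,3)]
                    padic_ints_two_mult[OF that(2) xy(5)]] D])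
          show "f c / 2 \<in> padic_ints 2" "g c / 2 \<in> padic_ints 2"
            using *[OF ch[OF c u(1)] ch[OF c w(1)] xy(4)] *[OF ch[OF c w(1)] ch[OF c u(1)] xy(3)]
            by (simp_all add: f_def g_def diff_divide_distrib mult.commute[of D])
        qed
        \<comment> \<open>\<open>f c\<close>, \<open>g c\<close>, \<open>x\<close> and
          \<open>y\<close> are all even, so each term of the norm of the plane component is
          divisible by 8; this sum is that norm divided by 8.\<close>
        have "f c / 2 * (f c / 2) * (x / 2) + f c / 2 * (g c / 2) * b + g c / 2 * (g c / 2) * (y / 2) \<in> padic_ints 2"
          using half xy by (intro padic_ints_two_add padic_ints_two_mult)
        then have "two_adic_cong ((f c)\<^sup>2 * x + 2 * f c * g c * b + (g c)\<^sup>2 * y) 0 8"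
          by (simp add: two_adic_cong_iff power2_eq_square field_simps)
        from two_adic_cong_add[OF this c']
        have "two_adic_cong ((f c)\<^sup>2 * x + 2 * f c * g c * b + (g c)\<^sup>2 * y + proj c \<bullet> proj c)
          (of_int (\<Sum>s\<in>S. oddity_term (s \<bullet> s))) 8" by simp
        moreover have "c \<bullet> c = (f c)\<^sup>2 * x + 2 * f c * g c * b + (g c)\<^sup>2 * y + proj c \<bullet> proj c"
        proof -
          define d where "d = proj c"
          have "d \<bullet> u = 0" "d \<bullet> w = 0" "u \<bullet> d = 0" "w \<bullet> d = 0"
            using projM[OF cM] by (simp_all add: V'_iff d_def inner_commute)
          moreover have "c = d + f c *\<^sub>R u + g c *\<^sub>R w" by (simp add: d_def proj_def)
          then have "c \<bullet> c = (d + f c *\<^sub>R u + g c *\<^sub>R w) \<bullet> (d + f c *\<^sub>R u + g c *\<^sub>R w)" by simp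
          ultimately show ?thesis
            by (simp add: inner_add_left inner_add_right inner_commute[of w u] power2_eq_square
                algebra_simps flip: x_def y_def b_def d_def)
        qed
        ultimately show ?thesis
          using two_adic_cong_trans[OF _ sum_cong, unfolded of_int_numeral] by simp
      qed
      then show ?thesis using ins2(1) by blast
    qed
  qed
qed

section \<open>Shadows\<close>

lemma padic_ints_two_det:
  fixes A :: "real^'n^'n"
  assumes "\<And>i j. A $ i $ j \<in> padic_ints 2"
  shows "det A \<in> padic_ints 2"
  unfolding det_def
  by (intro padic_ints_two_sum padic_ints_two_mult padic_ints_two_prod padic_ints_two_of_int assms)

lemma lattice_basis_memI:
  "lattice_basis b L \<Longrightarrow> (\<Sum>i\<in>UNIV. of_int (c i) *\<^sub>R b i) \<in> L"
  unfolding lattice_basis_def by blast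

lemma lattice_basis_in:
  assumes "lattice_basis b L"
  shows "b i \<in> L"
proof -
  have "b i = (\<Sum>j\<in>UNIV. of_int (if j = i then 1 else 0) *\<^sub>R b j)"
    by (simp add: if_distrib[of "\<lambda>a. of_int a *\<^sub>R _"] cong: if_cong)
  then show ?thesis using lattice_basis_memI[OF assms] by metis
qed

lemma lattice_basis_obtain:
  assumes "lattice_basis b L" "u \<in> L"
  obtains c where "u = (\<Sum>i\<in>UNIV. of_int (c i) *\<^sub>R b i)"
  using assms unfolding lattice_basis_def by blast

lemma lattice_basis_linear_combination:
  assumes "lattice_basis b L" "u \<in> L" "v \<in> L"
  shows "of_int m *\<^sub>R u + of_int n *\<^sub>R v \<in> L"
proof -
  obtain c where "u = (\<Sum>i\<in>UNIV. of_int (c i) *\<^sub>R b i)"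
    using lattice_basis_obtain[OF assms(1,2)] .
  moreover obtain d where "v = (\<Sum>i\<in>UNIV. of_int (d i) *\<^sub>R b i)"
    using lattice_basis_obtain[OF assms(1,3)] .
  ultimately have "of_int m *\<^sub>R u + of_int n *\<^sub>R v = (\<Sum>i\<in>UNIV. of_int (m * c i + n * d i) *\<^sub>R b i)"
    by (simp add: scaleR_sum_right scaleR_add_left sum.distrib)
  then show ?thesis using lattice_basis_memI[OF assms(1)] by metis
qed

lemma subset_rat_span: "L \<subseteq> rat_span L"
proof
  fix u assume "u \<in> L"
  then show "u \<in> rat_span L" unfolding rat_span_def by (intro CollectI exI[of _ 1] exI[of _ u]) simp
qed

text \<open>As \<open>rat_span\<close> consists of multiples of single lattice vectors, closure
  under addition needs a common denominator, here \<open>l * n\<close>.\<close>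

lemma rational_space_rat_span:
  assumes "rational_lattice L"
  shows "rational_space (rat_span L)"
proof -
  obtain b where b: "lattice_basis b L" using assms by (auto simp: rational_lattice_def)
  have rat: "u \<bullet> v \<in> \<rat>" if "u \<in> L" "v \<in> L" for u v
    using assms that by (auto simp: rational_lattice_def)
  show ?thesis
    unfolding rational_space_def
  proof (intro conjI ballI)
    have "0 *\<^sub>R b undefined \<in> rat_span L"
      unfolding rat_span_def using lattice_basis_in[OF b] Rats_0 by blast
    then show "0 \<in> rat_span L" by simp
  next
    fix x y assume "x \<in> rat_span L" "y \<in> rat_span L"
    then obtain q u r v where q: "q \<in> \<rat>" "u \<in> L" "x = q *\<^sub>R u" and r: "r \<in> \<rat>" "v \<in> L" "y = r *\<^sub>R v"
      unfolding rat_span_def by blast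
    obtain k l where k: "l > 0" "q = of_int k / of_int l" using Rats_cases'[OF q(1)] .
    obtain m n where m: "n > 0" "r = of_int m / of_int n" using Rats_cases'[OF r(1)] .
    have "x + y = (1 / of_int (l * n)) *\<^sub>R (of_int (k * n) *\<^sub>R u + of_int (m * l) *\<^sub>R v)"
      using k(1) m(1) unfolding q(3) r(3) k(2) m(2) by (simp add: scaleR_add_right)
    moreover have "1 / of_int (l * n) \<in> (\<rat> :: real set)" by (intro Rats_divide) auto
    ultimately show "x + y \<in> rat_span L"
      unfolding rat_span_def using lattice_basis_linear_combination[OF b q(2) r(2)] by blast
    show "x \<bullet> y \<in> \<rat>"
      using q r rat by (auto intro!: Rats_mult)
  next
    fix q :: real and x assume "q \<in> \<rat>" "x \<in> rat_span L"
    moreover from this obtain r u where "r \<in> \<rat>" "u \<in> L" "x = r *\<^sub>R u"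
      unfolding rat_span_def by blast
    ultimately show "q *\<^sub>R x \<in> rat_span L"
      unfolding rat_span_def by (intro CollectI exI[of _ "q * r"] exI[of _ u]) (auto intro: Rats_mult)
  qed
qed

text \<open>
  When \<open>L\<close> is unimodular at 2, this is the localization \<open>L \<otimes> \<int>\<^sub>(\<^sub>2\<^sub>)\<close>.
\<close>
definition two_adic_dual :: "(real^'n::finite) set \<Rightarrow> (real^'n) set" where
  "two_adic_dual L = {x \<in> rat_span L. \<forall>u\<in>L. x \<bullet> u \<in> padic_ints 2}"

text \<open>The coordinates of \<open>x\<close> solve a linear system with the Gram matrix and
  right-hand side \<open>x \<bullet> b j\<close>. Cramer's rule writes each as a determinant of
  2-integral entries divided by a unit.\<close>

lemma two_adic_dual_coefficients:
  fixes L :: "(real^'n::finite) set"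
  assumes b: "lattice_basis b L" and int: "two_integral L"
    and det: "two_adic_unit (det (\<chi> i j. b i \<bullet> b j))" and x: "x \<in> two_adic_dual L"
  obtains r where "\<And>i. r i \<in> padic_ints 2" "x = (\<Sum>i\<in>UNIV. r i *\<^sub>R b i)"
proof -
  define G where "G = (\<chi> i j. b i \<bullet> b j)"
  obtain q u where q: "u \<in> L" "x = q *\<^sub>R u"
    using x unfolding two_adic_dual_def rat_span_def by blast
  obtain c where "u = (\<Sum>i\<in>UNIV. of_int (c i) *\<^sub>R b i)"
    using lattice_basis_obtain[OF b q(1)] .
  then have xr: "x = (\<Sum>i\<in>UNIV. (q * of_int (c i)) *\<^sub>R b i)"
    using q by (simp add: scaleR_sum_right)
  define r where "r = (\<chi> i. q * of_int (c i))"
  have "G *v r = (\<chi> j. x \<bullet> b j)"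
    by (simp add: vec_eq_iff matrix_vector_mult_def G_def r_def xr inner_sum_left inner_sum_right
        inner_commute mult.commute)
  moreover have "det G \<noteq> 0" using det by (simp add: G_def two_adic_unit_def)
  ultimately have r: "r = (\<chi> k. det (\<chi> i j. if j = k then (\<chi> j. x \<bullet> b j) $ i else G $ i $ j) / det G)"
    using cramer by blast
  have "r $ k \<in> padic_ints 2" for k
  proof -
    have "r $ k = det (\<chi> i j. if j = k then (\<chi> j. x \<bullet> b j) $ i else G $ i $ j) / det G"
      by (subst r) simp
    also have "\<dots> \<in> padic_ints 2"
      using x int lattice_basis_in[OF b] det
      by (intro two_adic_unit_divide padic_ints_two_det)
        (auto simp: G_def two_adic_dual_def two_integral_def)
    finally show ?thesis .
  qed
  then show thesis using that[of "\<lambda>i. r $ i"] xr by (simp add: r_def)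
qed

text \<open>Expanding \<open>x\<close> in the basis suffices: \<open>y\<close> pairs integrally with
  each basis vector by definition.\<close>

lemma two_adic_dual_integral:
  assumes "lattice_basis b L" "two_integral L" "two_adic_unit (det (\<chi> i j. b i \<bullet> b j))"
    "x \<in> two_adic_dual L" "y \<in> two_adic_dual L"
  shows "x \<bullet> y \<in> padic_ints 2"
proof -
  obtain r where r: "\<And>i. r i \<in> padic_ints 2" "x = (\<Sum>i\<in>UNIV. r i *\<^sub>R b i)"
    using two_adic_dual_coefficients[OF assms(1-4)] by blast
  have "b i \<bullet> y \<in> padic_ints 2" for i
    using assms(5) lattice_basis_in[OF assms(1)] by (auto simp: two_adic_dual_def inner_commute)
  then show ?thesis
    unfolding r(2) by (auto simp: inner_sum_left intro!: padic_ints_two_sum padic_ints_two_mult r(1))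
qed

lemma subset_two_adic_dual: "two_integral L \<Longrightarrow> L \<subseteq> two_adic_dual L"
  using subset_rat_span by (auto simp: two_adic_dual_def two_integral_def)

lemma two_unimodular_two_adic_dual:
  assumes "lattice_basis b L" "two_integral L" "two_adic_unit (det (\<chi> i j. b i \<bullet> b j))"
  shows "two_unimodular (rat_span L) (two_adic_dual L)"
proof -
  have "x \<in> two_adic_dual L \<longleftrightarrow> x \<in> rat_span L \<and> (\<forall>u\<in>two_adic_dual L. x \<bullet> u \<in> padic_ints 2)" for x
    using subset_two_adic_dual[OF assms(2)] two_adic_dual_integral[OF assms, of x]
    by (auto simp: two_adic_dual_def)
  then show ?thesis unfolding two_unimodular_def by blast
qed

section \<open>The 2-level, Pi-duals and shadows\<close>

lemma two_level_eq_1: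
  assumes "lattice_basis b L" "two_integral L" "two_adic_unit (det (\<chi> i j. b i \<bullet> b j))"
  shows "two_level L = 1"
  unfolding two_level_def
proof (rule Least_equality)
  have "pi_dual {2} L \<subseteq> two_adic_dual L"
    unfolding pi_dual_def two_adic_dual_def using two_is_prime_nat by blast
  then show "0 < (1::nat) \<and> two_integral ((*\<^sub>R) (sqrt (real 1)) ` pi_dual {2} L)"
    using two_adic_dual_integral[OF assms] by (auto simp: two_integral_def)
qed simp

lemma Ints_subset_padic_ints: "prime p \<Longrightarrow> x \<in> \<int> \<Longrightarrow> x \<in> padic_ints p"
  unfolding padic_ints_def
  by (elim Ints_cases, intro CollectI exI conjI, rule div_by_1[symmetric, THEN trans])
    (auto simp: prime_nat_iff)

text \<open>\<open>m\<close> clears the denominators of the Gram matrix. Then \<open>m\<close> times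
  a vector of \<open>L\<close> has integral products with both \<open>L\<close> and
  \<open>dual_lattice L\<close>, so it meets the condition at every prime, whatever \<open>Q\<close>
  is.\<close>

lemma odd_multiple_in_pi_dual:
  assumes b: "lattice_basis b L" and int: "two_integral L"
  obtains m :: int where "odd m" "\<And>u. u \<in> L \<Longrightarrow> of_int m *\<^sub>R u \<in> pi_dual Q L"
proof -
  obtain m :: int where m: "odd m" "\<And>x. x \<in> range (\<lambda>(i, j). b i \<bullet> b j) \<Longrightarrow> of_int m * x \<in> \<int>"
  proof (rule padic_ints_two_odd_denominator)
    show "range (\<lambda>(i, j). b i \<bullet> b j) \<subseteq> padic_ints 2"
      using int lattice_basis_in[OF b] by (auto simp: two_integral_def)
  qed auto
  have mb: "of_int m * (b i \<bullet> b j) \<in> \<int>" for i j by (rule m(2)) auto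
  have mL: "of_int m * (u \<bullet> w) \<in> \<int>" if uw: "u \<in> L" "w \<in> L" for u w
  proof -
    obtain c where c: "u = (\<Sum>i\<in>UNIV. of_int (c i) *\<^sub>R b i)"
      using lattice_basis_obtain[OF b uw(1)] .
    obtain d where d: "w = (\<Sum>i\<in>UNIV. of_int (d i) *\<^sub>R b i)"
      using lattice_basis_obtain[OF b uw(2)] .
    have "of_int m * (u \<bullet> w) =
      (\<Sum>i\<in>UNIV. \<Sum>j\<in>UNIV. of_int (c i) * of_int (d j) * (of_int m * (b i \<bullet> b j)))"
      unfolding c d
      by (simp add: inner_sum_left inner_sum_right sum_distrib_left mult_ac) (rule sum.swap)
    also have "\<dots> \<in> \<int>" by (intro Ints_sum Ints_mult Ints_of_int mb)
    finally show ?thesis .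
  qed
  have "of_int m *\<^sub>R u \<in> pi_dual Q L" if u: "u \<in> L" for u
    unfolding pi_dual_def
  proof (intro CollectI conjI allI impI ballI)
    show "of_int m *\<^sub>R u \<in> rat_span L"
      unfolding rat_span_def using u
      by (intro CollectI exI[of _ "of_int m"] exI[of _ u]) auto
  next
    fix p :: nat and w assume "prime p" "w \<in> L"
    then show "of_int m *\<^sub>R u \<bullet> w \<in> padic_ints p"
      using mL[OF u] by (auto intro: Ints_subset_padic_ints)
  next
    fix p :: nat and w assume "prime p" "w \<in> dual_lattice L"
    then show "of_int m *\<^sub>R u \<bullet> w \<in> padic_ints p"
      using u by (auto simp: dual_lattice_def inner_commute[of u] intro!: Ints_subset_padic_ints Ints_mult)
  qed
  with m(1) that show thesis by blast
qed

text \<open>The shadow condition is given on the Pi-dual only. Every \<open>x\<close> of the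
  localization has an odd multiple there: \<open>n\<close> clears its coordinates to reach
  \<open>L\<close>, and \<open>m\<close> leads from \<open>L\<close> into the Pi-dual.\<close>

lemma shadow_pi_dual_characteristic_vector:
  assumes L: "rational_lattice L" and b: "lattice_basis b L" and int: "two_integral L"
    and det: "two_adic_unit (det (\<chi> i j. b i \<bullet> b j))" and v: "v \<in> shadow (pi_dual Q L)"
  shows "characteristic_vector (two_adic_dual L) (2 *\<^sub>R v)"
proof -
  note V = rational_space_rat_span[OF L]
  obtain m :: int where m: "odd m" "\<And>u. u \<in> L \<Longrightarrow> of_int m *\<^sub>R u \<in> pi_dual Q L"
    using odd_multiple_in_pi_dual[OF b int] by blast
  have ch: "(2 *\<^sub>R v \<bullet> x - x \<bullet> x) / 2 \<in> padic_ints 2" if x: "x \<in> two_adic_dual L" for x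
  proof -
    obtain r where r: "\<And>i. r i \<in> padic_ints 2" "x = (\<Sum>i\<in>UNIV. r i *\<^sub>R b i)"
      using two_adic_dual_coefficients[OF b int det x] by blast
    obtain n :: int where n: "odd n" "\<And>t. t \<in> range r \<Longrightarrow> of_int n * t \<in> \<int>"
      using padic_ints_two_odd_denominator[of "range r"] r(1) by auto
    have "\<forall>i. \<exists>c. of_int n * r i = of_int c" using n(2) by (metis Ints_cases rangeI)
    then obtain c where c: "\<And>i. of_int n * r i = of_int (c i)" by metis
    have "of_int n *\<^sub>R x = (\<Sum>i\<in>UNIV. of_int (c i) *\<^sub>R b i)"
      unfolding r(2) by (simp add: scaleR_sum_right c)
    then have "of_int n *\<^sub>R x \<in> L" using lattice_basis_memI[OF b] by metis
    then have "of_int m *\<^sub>R of_int n *\<^sub>R x \<in> pi_dual Q L" by (rule m(2))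
    moreover define k where "k = m * n"
    ultimately have kx: "of_int k *\<^sub>R x \<in> pi_dual Q L" by simp
    have k: "odd k" using m(1) n(1) by (simp add: k_def)
    then have k0: "real_of_int k \<noteq> 0" by auto
    have ku: "two_adic_unit (of_int k)"
      using k unfolding two_adic_unit_iff by (intro exI[of _ k] exI[of _ 1]) simp
    have "(2 * ((of_int k *\<^sub>R x) \<bullet> v) - (of_int k *\<^sub>R x) \<bullet> (of_int k *\<^sub>R x)) / 2 \<in> padic_ints 2"
      using v kx by (auto simp: shadow_def two_adic_cong_iff)
    then have "(2 * ((of_int k *\<^sub>R x) \<bullet> v) - (of_int k *\<^sub>R x) \<bullet> (of_int k *\<^sub>R x)) / 2 / of_int k \<in> padic_ints 2"
      using ku by (rule two_adic_unit_divide)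
    \<comment> \<open>Dividing the condition at \<open>k\<close> times \<open>x\<close> by
      \<open>k\<close> leaves \<open>k\<close> as a factor of \<open>x \<bullet> x\<close>. Being
      odd, \<open>k\<close> is reduced to 1 by adding an integral multiple of
      \<open>x \<bullet> x\<close>.\<close>
    moreover obtain j where j: "k = 2 * j + 1" using k by (auto elim: oddE)
    have "of_int j * (x \<bullet> x) \<in> padic_ints 2"
      using two_adic_dual_integral[OF b int det x x] by (intro padic_ints_two_mult) auto
    ultimately have "(2 * ((of_int k *\<^sub>R x) \<bullet> v) - (of_int k *\<^sub>R x) \<bullet> (of_int k *\<^sub>R x)) / 2 / of_int k
       + of_int j * (x \<bullet> x) \<in> padic_ints 2"
      by (rule padic_ints_two_add)
    moreover have "(2 * ((of_int k *\<^sub>R x) \<bullet> v) - (of_int k *\<^sub>R x) \<bullet> (of_int k *\<^sub>R x)) / 2 / of_int k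
       = v \<bullet> x - of_int k * (x \<bullet> x) / 2"
      using k0 by (simp add: field_simps inner_commute)
    ultimately have "v \<bullet> x - of_int k * (x \<bullet> x) / 2 + of_int j * (x \<bullet> x) \<in> padic_ints 2"
      by (simp only:)
    moreover have "v \<bullet> x - of_int k * (x \<bullet> x) / 2 + of_int j * (x \<bullet> x) = (2 *\<^sub>R v \<bullet> x - x \<bullet> x) / 2"
      by (simp add: j field_simps)
    ultimately show ?thesis by (simp only:)
  qed
  have "2 *\<^sub>R v \<in> two_adic_dual L"
    unfolding two_adic_dual_def
  proof (intro CollectI conjI ballI)
    obtain q d where "q \<in> \<rat>" "d \<in> pi_dual Q L" "v = q *\<^sub>R d"
      using v unfolding shadow_def rat_span_def by blast
    then show "2 *\<^sub>R v \<in> rat_span L"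
      using rational_spaceD(3)[OF V] by (auto simp: pi_dual_def)
    fix u assume "u \<in> L"
    then have u: "u \<in> two_adic_dual L" using subset_two_adic_dual[OF int] by blast
    have "2 * ((2 *\<^sub>R v \<bullet> u - u \<bullet> u) / 2) + u \<bullet> u \<in> padic_ints 2"
      using ch[OF u] two_adic_dual_integral[OF b int det u u] padic_ints_two_of_int[of 2]
      by (intro padic_ints_two_add padic_ints_two_mult) auto
    moreover have "2 * ((2 *\<^sub>R v \<bullet> u - u \<bullet> u) / 2) + u \<bullet> u = 2 *\<^sub>R v \<bullet> u"
      by (simp add: field_simps)
    ultimately show "2 *\<^sub>R v \<bullet> u \<in> padic_ints 2" by (simp only:)
  qed
  then show ?thesis
    using ch by (simp add: characteristic_vector_def two_adic_cong_iff)
qed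

section \<open>Comparison with the orthogonal basis chosen by the oddity\<close>

text \<open>Nonzero orthogonal vectors indexed by the coordinates are independent and as many as the
  dimension, so they span, and only 0 is orthogonal to them all.\<close>

lemma rational_orthogonal_basis_frame:
  fixes L :: "(real^'n::finite) set"
  assumes "rational_orthogonal_basis w L"
  shows "inj w" "orthogonal_frame (rat_span L) (range w)"
proof -
  have w: "w i \<in> rat_span L" "w i \<noteq> 0" "i \<noteq> j \<Longrightarrow> w i \<bullet> w j = 0" for i j
    using assms by (auto simp: rational_orthogonal_basis_def)
  show inj: "inj w"
    using w by (metis injI inner_eq_zero_iff)
  have orth: "pairwise orthogonal (range w)" "0 \<notin> range w"
    using w by (auto simp: pairwise_def orthogonal_def) metis
  then have "independent (range w)" by (rule pairwise_orthogonal_independent)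
  then have span: "UNIV \<subseteq> span (range w)"
    using card_image[OF inj] by (intro card_ge_dim_independent) auto
  have "x = 0" if "\<forall>s\<in>range w. x \<bullet> s = 0" for x
  proof -
    have "orthogonal x x"
      by (rule orthogonal_to_span[of x "range w"]) (use span that in \<open>auto simp: orthogonal_def\<close>)
    then show ?thesis by (simp add: orthogonal_def)
  qed
  then show "orthogonal_frame (rat_span L) (range w)"
    unfolding orthogonal_frame_def using orth w by auto
qed

text \<open>The frame spans the lattice basis and hence the whole space, so it has
  \<open>CARD('n)\<close> members and can be indexed by \<open>'n\<close>.\<close>

lemma rational_orthogonal_basis_exists:
  fixes L :: "(real^'n::finite) set"
  assumes L: "rational_lattice L" and b: "lattice_basis b L" and S: "orthogonal_frame (rat_span L) S"
  shows "\<exists>w. rational_orthogonal_basis w L"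
proof -
  have S': "finite S" "S \<subseteq> rat_span L" "0 \<notin> S" "pairwise orthogonal S"
    using S by (auto simp: orthogonal_frame_def)
  have "b i \<in> span S" for i
  proof -
    have "b i \<in> rat_span L" using lattice_basis_in[OF b] subset_rat_span by blast
    from orthogonal_frame_expansion[OF rational_space_rat_span[OF L] S this]
    show ?thesis by (metis (no_types, lifting) span_base span_scale span_sum)
  qed
  then have sub: "span (range b) \<subseteq> span S" by (intro span_minimal) auto
  have "card (range b) = CARD('n)" "independent (range b)"
    using b card_image[of b UNIV] by (auto simp: lattice_basis_def)
  then have "UNIV \<subseteq> span (range b)"
    by (intro card_ge_dim_independent) auto
  then have "span S = UNIV" using sub by blast
  moreover have "independent S" using S' by (intro pairwise_orthogonal_independent)
  ultimately have "card S = CARD('n)"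
    using dim_span_eq_card_independent[of S] by simp
  then obtain w :: "'n \<Rightarrow> real^'n" where w: "bij_betw w UNIV S"
    using finite_same_card_bij[of "UNIV :: 'n set" S] S'(1) by auto
  have "w i \<in> S" for i using w by (auto simp: bij_betw_def)
  moreover have "w i \<noteq> w j" if "i \<noteq> j" for i j using w that by (auto simp: bij_betw_def inj_def)
  ultimately have "rational_orthogonal_basis w L"
    using S' unfolding rational_orthogonal_basis_def pairwise_def orthogonal_def by (metis subsetD)
  then show ?thesis by blast
qed

lemma oddity_orthogonal_frame:
  assumes L: "rational_lattice L" and S: "orthogonal_frame (rat_span L) S"
  shows "oddity L = (\<Sum>s\<in>S. oddity_term (s \<bullet> s)) mod 8"
proof -
  obtain b where b: "lattice_basis b L" using L by (auto simp: rational_lattice_def)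
  define w where "w = (SOME w. rational_orthogonal_basis w L)"
  have "rational_orthogonal_basis w L"
    unfolding w_def by (rule someI_ex[OF rational_orthogonal_basis_exists[OF L b S]])
  note w = rational_orthogonal_basis_frame[OF this]
  have "oddity L = (\<Sum>s\<in>range w. oddity_term (s \<bullet> s)) mod 8"
    by (simp add: oddity_def Let_def sum.reindex[OF w(1)] flip: w_def)
  also have "\<dots> = (\<Sum>s\<in>S. oddity_term (s \<bullet> s)) mod 8"
    by (rule sum_oddity_term_orthogonal_frame[OF rational_space_rat_span[OF L] w(2) S])
  finally show ?thesis .
qed

theorem theorem7:
  fixes \<Lambda> :: "(real^'n::finite) set" and P :: "nat set" and v :: "real^'n"
  assumes "rational_lattice \<Lambda>"
    and "two_integral \<Lambda>"
    and "two_adic_unit (lattice_det \<Lambda>)"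
    and "\<forall>p\<in>P. prime p"
    and "v \<in> pi_shadow P \<Lambda>"
  shows "two_adic_cong (v \<bullet> v) (of_int (oddity \<Lambda>) / 4) 2"
proof -
  define b where "b = (SOME b. lattice_basis b \<Lambda>)"
  have b: "lattice_basis b \<Lambda>"
    unfolding b_def by (rule someI_ex[OF conjunct1[OF assms(1)[unfolded rational_lattice_def]]])
  have det: "two_adic_unit (det (\<chi> i j. b i \<bullet> b j))"
    using assms(3) by (simp add: lattice_det_def Let_def flip: b_def)
  \<comment> \<open>With level 1 the scaling by \<open>sqrt\<close> is trivial, and both branches of
    \<open>pi_shadow\<close> become the same shadow.\<close>
  have "v \<in> shadow (pi_dual {p. prime p \<and> p \<notin> P} \<Lambda>)"
    using assms(5) two_level_eq_1[OF b assms(2) det] by (auto simp: pi_shadow_def Let_def split: if_splits)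
  then have c: "characteristic_vector (two_adic_dual \<Lambda>) (2 *\<^sub>R v)"
    by (rule shadow_pi_dual_characteristic_vector[OF assms(1) b assms(2) det])
  obtain S where S: "orthogonal_frame (rat_span \<Lambda>) S"
    "\<And>c. characteristic_vector (two_adic_dual \<Lambda>) c \<Longrightarrow>
      two_adic_cong (c \<bullet> c) (of_int (\<Sum>s\<in>S. oddity_term (s \<bullet> s))) 8"
    using characteristic_vector_norm[OF rational_space_rat_span[OF assms(1)]
        two_unimodular_two_adic_dual[OF b assms(2) det]] by blast
  have "two_adic_cong (of_int (\<Sum>s\<in>S. oddity_term (s \<bullet> s))) (of_int (oddity \<Lambda>)) (of_int 8)"
    by (rule two_adic_cong_of_int_mod) (simp add: oddity_orthogonal_frame[OF assms(1) S(1)])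
  then have "two_adic_cong (2 *\<^sub>R v \<bullet> 2 *\<^sub>R v) (of_int (oddity \<Lambda>)) 8"
    using two_adic_cong_trans[OF S(2)[OF c]] by simp
  then show ?thesis
    \<comment> \<open>The norm of \<open>2 *\<^sub>R v\<close> is four times that of
      \<open>v\<close>; dividing by 4 turns the modulus 8 into 2.\<close>
    by (simp add: two_adic_cong_iff field_simps)
qed

end
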